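(* Let $k$ be a commutative ring and $A$ a commutative $k$-algebra such that $\operatorname{Der}_k(A)$ is a projective $A$-module of finite rank. The following are equivalent: (a) $\theta_{A/k}:\operatorname{gr}\operatorname{Diff}_{A/k}\to(\operatorname{Sym}\Omega_{A/k})^*_{gr}$ is an isomorphism; (b) $\vartheta_{A/k}:\Gamma\operatorname{Ider}_k(A)\to\operatorname{gr}\operatorname{Diff}_{A/k}$ is an isomorphism; (c) $\operatorname{Ider}_k(A)=\operatorname{Der}_k(A)$.
   Context: $\operatorname{HS}_k(A)$: infinite sequences $D=(D_0,D_1,\dots)$ of $k$-linear maps $A\to A$, $D_0=\mathrm{Id}$, $D_i(xy)=\sum_{r+s=i}D_r(x)D_s(y)$; $\operatorname{Ider}_k(A)=\{D_1:D\in\operatorname{HS}_k(A)\}\subset\operatorname{Der}_k(A)$. $\operatorname{gr}\operatorname{Diff}_{A/k}$: associated graded of the order filtration on $k$-linear differential operators of $A$ (order $0$ = multiplications; $\varphi$ order $\le i+1$ iff all $[\varphi,a]$ have order $\le i$), $\sigma_n$ symbol maps. $(\operatorname{Sym}\Omega_{A/k})^*_{gr}=\bigoplus_n\operatorname{Hom}_A(\operatorname{Sym}^n\Omega_{A/k},A)$ with the shuffle product $(u\star v)(\prod_{l=1}^{i+j}\omega_l)=\sum_{L\subset[i+j],\sharp L=i}u(\omega_L)v(\omega_{[i+j]\setminus L})$. $\theta_{A/k}=\bigoplus\theta_n$ with $\theta_n(\sigma_n(P))(dx_1\cdots dx_n)=\sum_{L\subset[n]}(-1)^{\sharp L}x_LP(x_{[n]\setminus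 L})$; it is an injective graded $A$-algebra homomorphism. $\Gamma N$: algebra of divided powers of an $A$-module $N$ with universal $A$-linear $\gamma:N\to\operatorname{EXP}(\Gamma N)$, $\gamma(x)=\sum\gamma_j(x)t^j$, where $\operatorname{EXP}(B)$ is the $A$-module of $\sum R_it^i\in B[[t]]$ with $R_0=1$, $\binom{i+j}{i}R_{i+j}=R_iR_j$. $\vartheta_{A/k}$ is the graded $A$-algebra homomorphism with $\vartheta_{A/k}(\gamma_j(\delta))=\sigma_j(D_j)$ for any $D\in\operatorname{HS}_k(A)$ with $D_1=\delta$ (well defined); in degree $1$ it is the inclusion $\operatorname{Ider}_k(A)\subset\operatorname{Der}_k(A)=\operatorname{gr}^1\operatorname{Diff}_{A/k}$. *)

theory Defs
  imports Main "HOL-Library.Multiset" "HOL-Library.Poly_Mapping"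
begin

text \<open>The base ring k is a type 'k :: comm_ring_1, the algebra A a type 'a :: comm_ring_1,
  and the k-algebra structure is a ring homomorphism phi : k -> A.\<close>

definition is_alg_map :: "('k::comm_ring_1 \<Rightarrow> 'a::comm_ring_1) \<Rightarrow> bool" where
  "is_alg_map phi \<longleftrightarrow> phi 0 = 0 \<and> phi 1 = 1 \<and>
     (\<forall>c d. phi (c + d) = phi c + phi d) \<and> (\<forall>c d. phi (c * d) = phi c * phi d)"

definition klin :: "('k::comm_ring_1 \<Rightarrow> 'a::comm_ring_1) \<Rightarrow> ('a \<Rightarrow> 'a) \<Rightarrow> bool" where
  "klin phi f \<longleftrightarrow> (\<forall>x y. f (x + y) = f x + f y) \<and> (\<forall>c x. f (phi c * x) = phi c * f x)"

definition Der :: "('k::comm_ring_1 \<Rightarrow> 'a::comm_ring_1) \<Rightarrow> ('a \<Rightarrow> 'a) set" where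
  "Der phi = {d. klin phi d \<and> (\<forall>x y. d (x * y) = x * d y + y * d x)}"

definition HS :: "('k::comm_ring_1 \<Rightarrow> 'a::comm_ring_1) \<Rightarrow> (nat \<Rightarrow> 'a \<Rightarrow> 'a) set" where
  "HS phi = {D. D 0 = id \<and> (\<forall>i. klin phi (D i)) \<and>
      (\<forall>i x y. D i (x * y) = (\<Sum>r\<le>i. D r x * D (i - r) y))}"

definition Ider :: "('k::comm_ring_1 \<Rightarrow> 'a::comm_ring_1) \<Rightarrow> ('a \<Rightarrow> 'a) set" where
  "Ider phi = {D 1 | D. D \<in> HS phi}"

text \<open>A set M of maps A -> A (an A-submodule under pointwise operations) is a projective
  A-module of finite rank: it is a direct summand of a finite free module A^n, i.e. there are
  A-linear maps e : M -> A^n and p : A^n -> M with p o e = id.  Vectors of A^n are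
  functions nat => 'a vanishing outside {..<n}.\<close>
definition fin_proj_module :: "('a::comm_ring_1 \<Rightarrow> 'a) set \<Rightarrow> bool" where
  "fin_proj_module M \<longleftrightarrow> (\<exists>(n::nat) (e :: ('a \<Rightarrow> 'a) \<Rightarrow> nat \<Rightarrow> 'a) (p :: (nat \<Rightarrow> 'a) \<Rightarrow> 'a \<Rightarrow> 'a).
      (\<forall>m\<in>M. \<forall>i\<ge>n. e m i = 0) \<and>
      (\<forall>m\<in>M. \<forall>m'\<in>M. e (\<lambda>x. m x + m' x) = (\<lambda>i. e m i + e m' i)) \<and>
      (\<forall>m\<in>M. \<forall>a. e (\<lambda>x. a * m x) = (\<lambda>i. a * e m i)) \<and>
      (\<forall>v. p v \<in> M) \<and>
      (\<forall>v w. p (\<lambda>i. v i + w i) = (\<lambda>x. p v x + p w x)) \<and>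
      (\<forall>v a. p (\<lambda>i. a * v i) = (\<lambda>x. a * p v x)) \<and>
      (\<forall>m\<in>M. p (e m) = m))"

fun diffop :: "('k::comm_ring_1 \<Rightarrow> 'a::comm_ring_1) \<Rightarrow> nat \<Rightarrow> ('a \<Rightarrow> 'a) \<Rightarrow> bool" where
  "diffop phi 0 P \<longleftrightarrow> (\<exists>a. P = (\<lambda>x. a * x))"
| "diffop phi (Suc n) P \<longleftrightarrow> klin phi P \<and> (\<forall>a. diffop phi n (\<lambda>x. P (a * x) - a * P x))"

text \<open>lower order part: gr^n Diff = Diff_n / lowerord n, with Diff_{-1} = 0\<close>
definition lowerord :: "('k::comm_ring_1 \<Rightarrow> 'a::comm_ring_1) \<Rightarrow> nat \<Rightarrow> ('a \<Rightarrow> 'a) \<Rightarrow> bool" where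
  "lowerord phi n P \<longleftrightarrow> (if n = 0 then P = (\<lambda>x. 0) else diffop phi (n - 1) P)"

text \<open>Hom_A(Sym^n Omega_{A/k}, A): Sym^n Omega is the A-module generated by the monomials
  dx_1 ... dx_n subject to symmetry, k-linearity and the Leibniz rule in each factor, so an
  A-linear u is the same as its values u(dx_1...dx_n), a function on lists of length n that is
  symmetric and a k-derivation in (by symmetry: the first, hence every) slot.
  Such u are represented as functions on lists, vanishing off length n.\<close>
definition symhom :: "('k::comm_ring_1 \<Rightarrow> 'a::comm_ring_1) \<Rightarrow> nat \<Rightarrow> ('a list \<Rightarrow> 'a) \<Rightarrow> bool" where
  "symhom phi n u \<longleftrightarrow>
     (\<forall>xs. length xs \<noteq> n \<longrightarrow> u xs = 0) \<and>
     (\<forall>xs ys. length xs = n \<longrightarrow> mset xs = mset ys \<longrightarrow> u xs = u ys) \<and>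
     (\<forall>x y zs. Suc (length zs) = n \<longrightarrow>
        u ((x + y) # zs) = u (x # zs) + u (y # zs) \<and>
        (\<forall>c. u ((phi c * x) # zs) = phi c * u (x # zs)) \<and>
        u ((x * y) # zs) = x * u (y # zs) + y * u (x # zs))"

definition thetaN :: "nat \<Rightarrow> ('a::comm_ring_1 \<Rightarrow> 'a) \<Rightarrow> 'a list \<Rightarrow> 'a" where
  "thetaN n P xs = (if length xs = n then
      (\<Sum>L\<in>Pow {..<n}. (-1) ^ card L * (\<Prod>l\<in>L. xs ! l) * P (\<Prod>l\<in>{..<n} - L. xs ! l))
     else 0)"

text \<open>theta_{A/k} is an isomorphism: in each degree n the induced map
  gr^n Diff -> Hom_A(Sym^n Omega, A) is well defined, injective and surjective.\<close>
definition theta_iso :: "('k::comm_ring_1 \<Rightarrow> 'a::comm_ring_1) \<Rightarrow> bool" where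
  "theta_iso phi \<longleftrightarrow> (\<forall>n.
     (\<forall>P. diffop phi n P \<longrightarrow> symhom phi n (thetaN n P)) \<and>
     (\<forall>P. diffop phi n P \<longrightarrow> (thetaN n P = (\<lambda>xs. 0) \<longleftrightarrow> lowerord phi n P)) \<and>
     (\<forall>u. symhom phi n u \<longrightarrow> (\<exists>P. diffop phi n P \<and> thetaN n P = u)))"

text \<open>Gamma N for an A-submodule N of A -> A, by the standard (Roby) presentation:
  the polynomial A-algebra on symbols gamma_j(x) (x in N, j >= 0) modulo the ideal generated by
  gamma_0(x) = 1, gamma_i(x) gamma_j(x) = binom(i+j,i) gamma_{i+j}(x),
  gamma_j(a x) = a^j gamma_j(x), gamma_n(x+y) = sum_{i<=n} gamma_i(x) gamma_{n-i}(y).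
  Polynomials: finitely supported maps from monomials (multisets of variables) to A.\<close>

type_synonym 'a gpoly = "(('a \<Rightarrow> 'a) \<times> nat) multiset \<Rightarrow>\<^sub>0 'a"

definition gvar :: "('a::comm_ring_1 \<Rightarrow> 'a) \<Rightarrow> nat \<Rightarrow> 'a gpoly" where
  "gvar x j = Poly_Mapping.single {#(x, j)#} 1"

definition gconst :: "'a::comm_ring_1 \<Rightarrow> 'a gpoly" where
  "gconst a = Poly_Mapping.single {#} a"

definition gpoly_over :: "('a::comm_ring_1 \<Rightarrow> 'a) set \<Rightarrow> 'a gpoly \<Rightarrow> bool" where
  "gpoly_over N f \<longleftrightarrow> (\<forall>m\<in>Poly_Mapping.keys f. \<forall>v\<in>#m. fst v \<in> N)"

definition gdeg :: "(('a \<Rightarrow> 'a) \<times> nat) multiset \<Rightarrow> nat" where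
  "gdeg m = sum_mset (image_mset snd m)"

definition ghomog :: "nat \<Rightarrow> 'a::comm_ring_1 gpoly \<Rightarrow> bool" where
  "ghomog n f \<longleftrightarrow> (\<forall>m\<in>Poly_Mapping.keys f. gdeg m = n)"

definition Gamma_rels :: "('a::comm_ring_1 \<Rightarrow> 'a) set \<Rightarrow> 'a gpoly set" where
  "Gamma_rels N =
     {gvar x 0 - 1 | x. x \<in> N} \<union>
     {gvar x i * gvar x j - of_nat ((i + j) choose i) * gvar x (i + j) | x i j. x \<in> N} \<union>
     {gvar (\<lambda>t. a * x t) j - gconst (a ^ j) * gvar x j | x a j. x \<in> N} \<union>
     {gvar (\<lambda>t. x t + y t) n - (\<Sum>i\<le>n. gvar x i * gvar y (n - i)) | x y n. x \<in> N \<and> y \<in> N}"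

definition Gamma_ideal :: "('a::comm_ring_1 \<Rightarrow> 'a) set \<Rightarrow> 'a gpoly set" where
  "Gamma_ideal N = {sum_list (map (\<lambda>(r, g). r * g) ps) | ps.
      \<forall>(r, g)\<in>set ps. gpoly_over N r \<and> g \<in> Gamma_rels N}"

text \<open>a chosen Hasse--Schmidt derivation with D_1 = delta (for delta in Ider);
  by the well-definedness of vartheta the choice does not matter modulo lower order.\<close>
definition hsop :: "('k::comm_ring_1 \<Rightarrow> 'a::comm_ring_1) \<Rightarrow> ('a \<Rightarrow> 'a) \<Rightarrow> nat \<Rightarrow> 'a \<Rightarrow> 'a" where
  "hsop phi d j = (SOME D. D \<in> HS phi \<and> D 1 = d) j"

text \<open>image of a monomial prod gamma_{j_i}(delta_i): the composite of the D^{(i)}_{j_i}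
  (gr Diff is commutative, so the order is irrelevant modulo lower order)\<close>
definition mono_op :: "('k::comm_ring_1 \<Rightarrow> 'a::comm_ring_1) \<Rightarrow> (('a \<Rightarrow> 'a) \<times> nat) multiset \<Rightarrow> 'a \<Rightarrow> 'a" where
  "mono_op phi m = foldr (\<lambda>(d, j) Q. hsop phi d j \<circ> Q) (SOME xs. mset xs = m) id"

definition varthetaP :: "('k::comm_ring_1 \<Rightarrow> 'a::comm_ring_1) \<Rightarrow> 'a gpoly \<Rightarrow> 'a \<Rightarrow> 'a" where
  "varthetaP phi f = (\<lambda>x. \<Sum>m\<in>Poly_Mapping.keys f. Poly_Mapping.lookup f m * mono_op phi m x)"

definition vartheta_iso :: "('k::comm_ring_1 \<Rightarrow> 'a::comm_ring_1) \<Rightarrow> bool" where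
  "vartheta_iso phi \<longleftrightarrow> (\<forall>n.
     (\<forall>f. gpoly_over (Ider phi) f \<longrightarrow> ghomog n f \<longrightarrow> diffop phi n (varthetaP phi f)) \<and>
     (\<forall>f. gpoly_over (Ider phi) f \<longrightarrow> ghomog n f \<longrightarrow>
          (lowerord phi n (varthetaP phi f) \<longleftrightarrow> f \<in> Gamma_ideal (Ider phi))) \<and>
     (\<forall>P. diffop phi n P \<longrightarrow> (\<exists>f. gpoly_over (Ider phi) f \<and> ghomog n f \<and>
          lowerord phi n (\<lambda>x. P x - varthetaP phi f x))))"

end

theory Submission
  imports Defs "HOL-Computational_Algebra.Formal_Power_Series"
begin

text \<open>The value of \<open>\<theta>\<^sub>n(P)\<close> at \<open>dx\<^sub>1 \<dots> dx\<^sub>n\<close> is the iterated commutator \<open>[\<dots>[P, x\<^sub>1], \<dots>, x\<^sub>n](1)\<close>;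
  hence P has order at most n iff \<open>\<theta>\<^sub>n\<^sub>+\<^sub>1(P) = 0\<close>, which gives the injectivity of \<open>\<theta>\<close>.

  If \<open>\<theta>\<close> is surjective, a Hasse--Schmidt derivation of length n extends to length n + 1: the
  iterated commutators of the next term are prescribed except in degree 1, and an operator with
  these commutators is found degree by degree from the top.  So every derivation is integrable.
  If \<open>\<vartheta>\<close> is surjective, look at degree 1.

  Conversely, \<open>\<theta> \<circ> \<vartheta>\<close> is the canonical map from \<open>\<Gamma>\<close> Ider to symmetric multiderivations.  When
  Ider = Der is projective with dual basis \<open>(b\<^sub>i, c\<^sub>i)\<close>, it is inverted by
  \<open>u \<mapsto> \<Sum>\<^bsub>\<alpha>\<^esub> c\<^sup>\<alpha>(u) \<Prod>\<^sub>i \<gamma>\<^bsub>\<alpha>\<^sub>i\<^esub>(b\<^sub>i)\<close>, where \<open>c\<^sub>i\<close> contracts the first argument and acts as a derivation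
  of the shuffle product.  Injectivity of \<open>\<theta>\<close> then makes both maps bijective.\<close>

section \<open>Iterated commutators and the symbol map\<close>

text \<open>Differentials never occur as elements: the projectivity is that of the dual of \<Omega>,
  so multiderivations are handled as functions on words and inductions run along the first letter.
  Removing that letter is a commutator on operators and a derivation on the shuffle algebra; the
  whole comparison rests on this match. For integrability, degree 1 has to stay free: the Leibniz
  rule for the next term prescribes its commutators on two or more letters, while the one-letter
  value is the unknown operator itself, up to its value at 1. For the inverse map, the elements
  \<open>b i\<close> need not be independent. Coordinates are then not unique, and the polynomial
  attached to a multiderivation behaves well only modulo the relations of \<Gamma>. Pairing the
  \<open>a\<close>-fold contraction with the divided power of \<open>b i\<close>, rather than with
  its ordinary power, avoids a division by \<open>a!\<close>.\<close>

definition comm :: "('a::comm_ring_1 \<Rightarrow> 'a) \<Rightarrow> 'a \<Rightarrow> 'a \<Rightarrow> 'a" where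
  "comm P a = (\<lambda>x. P (a * x) - a * P x)"

lemma klin_add: "klin phi P \<Longrightarrow> P (x + y) = P x + P y"
  and klin_scale: "klin phi P \<Longrightarrow> P (phi c * x) = phi c * P x"
  by (auto simp: klin_def)

lemma klin_zero: "klin phi P \<Longrightarrow> P 0 = 0"
  by (metis add_cancel_right_right klin_add)

lemma klin_minus: "klin phi P \<Longrightarrow> P (- x) = - P x"
  by (metis add_eq_0_iff klin_add klin_zero)

lemma klin_diff: "klin phi P \<Longrightarrow> P (x - y) = P x - P y"
  by (metis klin_add klin_minus uminus_add_conv_diff add.commute)

lemma klin_sum: "klin phi P \<Longrightarrow> P (sum f I) = (\<Sum>i\<in>I. P (f i))"
  by (induction I rule: infinite_finite_induct) (auto simp: klin_zero klin_add)

lemma klin_mult_left: "klin phi (\<lambda>x. a * x)"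
  by (simp add: klin_def algebra_simps)

lemma klin_comm: "klin phi P \<Longrightarrow> klin phi (comm P a)"
  by (simp add: klin_def comm_def distrib_left right_diff_distrib mult.left_commute[of a])

lemma klin_plus: "klin phi P \<Longrightarrow> klin phi Q \<Longrightarrow> klin phi (\<lambda>x. P x + Q x)"
  and klin_times: "klin phi P \<Longrightarrow> klin phi (\<lambda>x. a * P x)"
  and klin_zero_fun: "klin phi (\<lambda>x. 0)"
  and klin_comp: "klin phi P \<Longrightarrow> klin phi Q \<Longrightarrow> klin phi (P \<circ> Q)"
  and klin_subtract: "klin phi P \<Longrightarrow> klin phi Q \<Longrightarrow> klin phi (\<lambda>x. P x - Q x)"
  by (auto simp: klin_def algebra_simps)

lemma klin_sum_fun: "(\<And>i. i \<in> I \<Longrightarrow> klin phi (P i)) \<Longrightarrow> klin phi (\<lambda>x. \<Sum>i\<in>I. P i x)"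
  by (induction I rule: infinite_finite_induct) (auto intro: klin_plus klin_zero_fun)

lemma comm_commute: "comm (comm P a) b = comm (comm P b) a"
  by (simp add: comm_def fun_eq_iff algebra_simps)

lemma comm_plus: "comm (\<lambda>x. P x + Q x) a = (\<lambda>x. comm P a x + comm Q a x)"
  and comm_times: "comm (\<lambda>x. b * P x) a = (\<lambda>x. b * comm P a x)"
  and comm_zero: "comm (\<lambda>x. 0) a = (\<lambda>x. 0)"
  and comm_mult_left: "comm (\<lambda>x. b * x) a = (\<lambda>x. 0)"
  by (simp_all add: comm_def fun_eq_iff algebra_simps)

lemma comm_comp:
  "klin phi P \<Longrightarrow> comm (P \<circ> Q) a = (\<lambda>x. (comm P a \<circ> Q) x + (P \<circ> comm Q a) x)"
  by (simp add: comm_def fun_eq_iff klin_diff)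

lemma comm_mult:
  "comm P (a * b) = (\<lambda>x. a * comm P b x + b * comm P a x + comm (comm P a) b x)"
  by (simp add: comm_def fun_eq_iff algebra_simps)

lemma thetaN_length: "length xs \<noteq> n \<Longrightarrow> thetaN n P xs = 0"
  by (simp add: thetaN_def)

lemma thetaN_0: "thetaN 0 P [] = P 1"
  by (simp add: thetaN_def)

text \<open>Split the subsets \<open>L\<close> by whether they contain the first index: if not,
  \<open>x\<close> enters the argument of \<open>P\<close>; if so, a factor \<open>- x\<close> comes
  out in front. Together the two halves form the commutator of \<open>P\<close> with
  \<open>x\<close>.\<close>

lemma thetaN_Suc: "thetaN (Suc n) P (x # xs) = thetaN n (comm P x) xs"
proof (cases "length xs = n")
  case True
  let ?t = "\<lambda>L. (-1) ^ card L * (\<Prod>l\<in>L. (x # xs) ! l) * P (\<Prod>l\<in>{..<Suc n} - L. (x # xs) ! l)"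
  let ?A = "Pow {..<n}"
  have fin: "finite L" if "L \<in> ?A" for L
    using that finite_subset by auto
  have split: "Pow {..<Suc n} = (\<lambda>L. Suc ` L) ` ?A \<union> (\<lambda>L. insert 0 (Suc ` L)) ` ?A"
  proof -
    have "{..<Suc n} = insert 0 (Suc ` {..<n})"
      by (auto simp: image_iff less_Suc_eq_0_disj)
    then show ?thesis
      by (simp only: Pow_insert image_Pow_surj[OF refl, symmetric] image_image)
  qed
  have inj1: "inj_on (\<lambda>L. Suc ` L) ?A"
    by (auto simp: inj_on_def inj_image_eq_iff)
  have inj2: "inj_on (\<lambda>L. insert 0 (Suc ` L)) ?A"
  proof (rule inj_onI)
    fix L M :: "nat set" assume "insert 0 (Suc ` L) = insert 0 (Suc ` M)"
    then have "Suc ` L = Suc ` M"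
      by (metis Diff_insert_absorb image_iff nat.distinct(1))
    then show "L = M" by (simp add: inj_image_eq_iff)
  qed
  have disj: "(\<lambda>L. Suc ` L) ` ?A \<inter> (\<lambda>L. insert 0 (Suc ` L)) ` ?A = {}"
    by auto
  have c1: "{..<Suc n} - Suc ` L = insert 0 (Suc ` ({..<n} - L))" for L
    by (auto simp: lessThan_Suc_eq_insert_0)
  have c2: "{..<Suc n} - insert 0 (Suc ` L) = Suc ` ({..<n} - L)" for L
    by (auto simp: lessThan_Suc_eq_insert_0)
  have t1: "?t (Suc ` L) = (-1) ^ card L * (\<Prod>l\<in>L. xs ! l) * P (x * (\<Prod>l\<in>{..<n} - L. xs ! l))"
    if "L \<in> ?A" for L
    by (simp add: c1 card_image prod.reindex fin that)
  have t2: "?t (insert 0 (Suc ` L)) = - ((-1) ^ card L * (\<Prod>l\<in>L. xs ! l) * (x * P (\<Prod>l\<in>{..<n} - L. xs ! l)))"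
    if "L \<in> ?A" for L
    unfolding c2 using fin[OF that] by (simp add: card_image prod.reindex)
  have "thetaN (Suc n) P (x # xs) = (\<Sum>L\<in>Pow {..<Suc n}. ?t L)"
    by (simp add: thetaN_def True)
  also have "\<dots> = (\<Sum>L\<in>?A. ?t (Suc ` L)) + (\<Sum>L\<in>?A. ?t (insert 0 (Suc ` L)))"
    unfolding split
    by (subst sum.union_disjoint[OF _ _ disj]) (simp_all only: sum.reindex[OF inj1] sum.reindex[OF inj2]
        comp_def finite_imageI finite_Pow_iff finite_lessThan)
  also have "\<dots> = (\<Sum>L\<in>?A. (-1) ^ card L * (\<Prod>l\<in>L. xs ! l) * comm P x (\<Prod>l\<in>{..<n} - L. xs ! l))"
    unfolding sum.distrib[symmetric]
    by (rule sum.cong[OF refl], subst t1, assumption, subst t2, assumption)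
      (simp add: comm_def right_diff_distrib)
  also have "\<dots> = thetaN n (comm P x) xs"
    by (simp add: thetaN_def True)
  finally show ?thesis .
qed (simp add: thetaN_def)

lemma thetaN_zero: "thetaN n (\<lambda>x. 0) = (\<lambda>xs. 0)"
  by (simp add: thetaN_def fun_eq_iff)

lemma thetaN_plus: "thetaN n (\<lambda>x. P x + Q x) xs = thetaN n P xs + thetaN n Q xs"
  by (simp add: thetaN_def algebra_simps sum.distrib)

lemma thetaN_times: "thetaN n (\<lambda>x. a * P x) xs = a * thetaN n P xs"
  by (simp add: thetaN_def sum_distrib_left algebra_simps)

lemma thetaN_sum: "thetaN n (\<lambda>x. \<Sum>i\<in>I. P i x) xs = (\<Sum>i\<in>I. thetaN n (P i) xs)"
  by (induction I rule: infinite_finite_induct) (auto simp: thetaN_zero thetaN_plus)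

lemma thetaN_diff: "thetaN n (\<lambda>x. P x - Q x) xs = thetaN n P xs - thetaN n Q xs"
  using thetaN_plus[of n P "\<lambda>x. - 1 * Q x"] thetaN_times[of n "-1" Q] by simp

lemma thetaN_fold: "length xs = n \<Longrightarrow> thetaN n P xs = fold (\<lambda>x Q. comm Q x) xs P 1"
  by (induction xs arbitrary: n P) (auto simp: thetaN_0 thetaN_Suc)

lemma thetaN_mset:
  assumes "mset xs = mset ys" shows "thetaN n P xs = thetaN n P ys"
proof (cases "length xs = n")
  case True
  moreover have "length ys = n" using assms True by (metis size_mset)
  moreover have "fold (\<lambda>x Q. comm Q x) xs = fold (\<lambda>x Q. comm Q x) ys"
    by (rule fold_multiset_equiv[OF _ assms]) (simp add: fun_eq_iff comm_commute[unfolded fun_eq_iff])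
  ultimately show ?thesis by (simp add: thetaN_fold)
next
  case False
  then have "length ys \<noteq> n" using assms by (metis size_mset)
  then show ?thesis using False by (simp add: thetaN_length)
qed

text \<open>The defect of the Leibniz rule in one slot is a value one degree higher. It vanishes for
  operators of order at most \<open>Suc m\<close>; for general \<open>P\<close> it is the model for
  the hypothesis \<open>mult\<close> of \<open>commutator_family_lift\<close>.\<close>

lemma thetaN_Cons_mult:
  assumes "length zs = m"
  shows "thetaN (Suc m) P ((x * y) # zs) =
    x * thetaN (Suc m) P (y # zs) + y * thetaN (Suc m) P (x # zs) + thetaN (Suc (Suc m)) P (x # y # zs)"
  by (simp add: assms thetaN_Suc comm_mult thetaN_plus thetaN_times)

lemma thetaN_Cons_add:
  assumes "klin phi P"
  shows "thetaN (Suc m) P ((x + y) # zs) = thetaN (Suc m) P (x # zs) + thetaN (Suc m) P (y # zs)"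
  by (simp add: thetaN_Suc comm_def distrib_right klin_add[OF assms] algebra_simps flip: thetaN_plus)

lemma thetaN_Cons_scale:
  assumes "klin phi P"
  shows "thetaN (Suc m) P ((phi c * x) # zs) = phi c * thetaN (Suc m) P (x # zs)"
proof -
  have "comm P (phi c * x) = (\<lambda>z. phi c * comm P x z)"
    by (simp add: comm_def mult.assoc klin_scale[OF assms] right_diff_distrib)
  then show ?thesis by (simp add: thetaN_Suc thetaN_times)
qed

section \<open>Differential operators\<close>

lemma diffop_klin: "diffop phi n P \<Longrightarrow> klin phi P"
  by (cases n) (auto simp: klin_mult_left)

lemma diffop_Suc_comm: "diffop phi (Suc n) P \<longleftrightarrow> klin phi P \<and> (\<forall>a. diffop phi n (comm P a))"
  by (simp add: comm_def)

declare diffop.simps(2) [simp del]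

lemma diffop_zero: "diffop phi n (\<lambda>x. 0)"
proof (induction n)
  case 0
  have "(\<lambda>x. 0) = (\<lambda>x::'b. 0 * x)" by simp
  then show ?case unfolding diffop.simps by blast
qed (simp add: diffop_Suc_comm klin_zero_fun comm_zero)

lemma diffop_plus: "diffop phi n P \<Longrightarrow> diffop phi n Q \<Longrightarrow> diffop phi n (\<lambda>x. P x + Q x)"
proof (induction n arbitrary: P Q)
  case 0
  then show ?case by (auto simp flip: distrib_right)
qed (simp add: diffop_Suc_comm klin_plus comm_plus)

lemma diffop_times: "diffop phi n P \<Longrightarrow> diffop phi n (\<lambda>x. a * P x)"
proof (induction n arbitrary: P)
  case 0
  then show ?case by (auto simp flip: mult.assoc)
qed (simp add: diffop_Suc_comm klin_times comm_times)

lemma diffop_subtract: "diffop phi n P \<Longrightarrow> diffop phi n Q \<Longrightarrow> diffop phi n (\<lambda>x. P x - Q x)"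
  using diffop_plus[of phi n P "\<lambda>x. - 1 * Q x"] diffop_times[of phi n Q "-1"] by simp

lemma diffop_sum: "(\<And>i. i \<in> I \<Longrightarrow> diffop phi n (P i)) \<Longrightarrow> diffop phi n (\<lambda>x. \<Sum>i\<in>I. P i x)"
  by (induction I rule: infinite_finite_induct) (auto intro: diffop_plus diffop_zero simp: diffop_zero)

lemma diffop_Suc: "diffop phi n P \<Longrightarrow> diffop phi (Suc n) P"
proof (induction n arbitrary: P)
  case 0
  then obtain a where "P = (\<lambda>x. a * x)" by auto
  then show ?case by (simp add: diffop_Suc_comm klin_mult_left comm_mult_left diffop_zero del: diffop.simps)
next
  case (Suc n)
  then show ?case unfolding diffop_Suc_comm[of phi "Suc n"] diffop_Suc_comm[of phi n P] by blast
qed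

lemma diffop_mono: "diffop phi m P \<Longrightarrow> m \<le> n \<Longrightarrow> diffop phi n P"
  by (induction n) (auto simp: le_Suc_eq diffop_Suc)

text \<open>Evaluating the iterated commutators at 1 loses nothing: at the bottom,
  \<open>comm P x 1 = 0\<close> for all \<open>x\<close> says \<open>P x = P 1 * x\<close>, and each
  further order moves one letter into \<open>P\<close>.\<close>

lemma diffop_iff_thetaN: "diffop phi n P \<longleftrightarrow> klin phi P \<and> thetaN (Suc n) P = (\<lambda>xs. 0)"
proof (induction n arbitrary: P)
  case 0
  have *: "thetaN (Suc 0) P = (\<lambda>xs. 0) \<longleftrightarrow> (\<forall>x. comm P x 1 = 0)"
  proof
    assume "thetaN (Suc 0) P = (\<lambda>xs. 0)"
    then show "\<forall>x. comm P x 1 = 0" by (metis thetaN_Suc thetaN_0)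
  next
    assume "\<forall>x. comm P x 1 = 0"
    then have "thetaN (Suc 0) P xs = 0" for xs
      by (cases "length xs = Suc 0") (auto simp: length_Suc_conv thetaN_Suc thetaN_0 thetaN_length)
    then show "thetaN (Suc 0) P = (\<lambda>xs. 0)" by auto
  qed
  show ?case
  proof
    assume "diffop phi 0 P"
    then obtain a where P: "P = (\<lambda>x. a * x)" by auto
    show "klin phi P \<and> thetaN (Suc 0) P = (\<lambda>xs. 0)"
      unfolding * unfolding P comm_mult_left by (simp add: klin_mult_left)
  next
    assume "klin phi P \<and> thetaN (Suc 0) P = (\<lambda>xs. 0)"
    then have "comm P x 1 = 0" for x unfolding * by blast
    from this[unfolded comm_def] have "P x = P 1 * x" for x
      by (metis eq_iff_diff_eq_0 mult.commute mult_1_right)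
    then have "P = (\<lambda>x. P 1 * x)" by (rule ext)
    then show "diffop phi 0 P" unfolding diffop.simps by (rule exI)
  qed
next
  case (Suc n)
  have "(\<forall>a. thetaN (Suc n) (comm P a) = (\<lambda>xs. 0)) \<longleftrightarrow> thetaN (Suc (Suc n)) P = (\<lambda>xs. 0)"
  proof
    assume *: "\<forall>a. thetaN (Suc n) (comm P a) = (\<lambda>xs. 0)"
    have "thetaN (Suc (Suc n)) P xs = 0" for xs
      using * by (cases xs) (auto simp: thetaN_Suc thetaN_length)
    then show "thetaN (Suc (Suc n)) P = (\<lambda>xs. 0)" by auto
  qed (auto simp: fun_eq_iff simp flip: thetaN_Suc)
  then show ?case by (auto simp: diffop_Suc_comm Suc klin_comm)
qed

lemma lowerord_iff_thetaN:
  assumes "diffop phi n P"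
  shows "lowerord phi n P \<longleftrightarrow> thetaN n P = (\<lambda>xs. 0)"
proof (cases n)
  case 0
  then obtain a where P: "P = (\<lambda>x. a * x)" using assms by auto
  have "thetaN 0 P = (\<lambda>xs. 0) \<longleftrightarrow> a = 0"
  proof
    assume "thetaN 0 P = (\<lambda>xs. 0)"
    then show "a = 0" using thetaN_0[of P] P by simp
  qed (simp add: P thetaN_zero)
  moreover have "P = (\<lambda>x. 0) \<longleftrightarrow> a = 0"
    using P by (metis mult_1_right mult_zero_left)
  ultimately show ?thesis using 0 by (simp add: lowerord_def)
next
  case (Suc m)
  then show ?thesis using diffop_klin[OF assms] by (simp add: lowerord_def diffop_iff_thetaN)
qed

lemma thetaN_above:
  assumes "diffop phi n P" "n < m" shows "thetaN m P = (\<lambda>xs. 0)"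
proof -
  from \<open>n < m\<close> have "diffop phi (m - 1) P" using assms diffop_mono by (metis Suc_pred' less_Suc_eq_le gr_implies_not0 not_gr_zero)
  then show ?thesis using \<open>n < m\<close> by (simp add: diffop_iff_thetaN)
qed

text \<open>The commutator with \<open>a\<close> obeys the Leibniz rule for composition, so both
  summands have smaller total order. A factor of order 0 has commutator zero, hence the separate
  cases.\<close>

lemma diffop_comp:
  "diffop phi i P \<Longrightarrow> diffop phi j Q \<Longrightarrow> diffop phi (i + j) (P \<circ> Q)"
proof (induction "i + j" arbitrary: i j P Q)
  case 0
  then obtain a b where "P = (\<lambda>x. a * x)" "Q = (\<lambda>x. b * x)" by auto
  then have "P \<circ> Q = (\<lambda>x. (a * b) * x)" by (auto simp: mult.assoc)
  then show ?case using 0 by auto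
next
  case (Suc n)
  have kP: "klin phi P" and kQ: "klin phi Q" using Suc.prems diffop_klin by blast+
  have 1: "diffop phi n (comm P a \<circ> Q)" for a
  proof (cases i)
    case 0
    then show ?thesis using Suc.prems by (auto simp: comm_mult_left comp_def diffop_zero)
  next
    case (Suc i')
    then show ?thesis using Suc.hyps(1)[of i' j "comm P a" Q] Suc.hyps(2) Suc.prems
      by (simp add: diffop_Suc_comm)
  qed
  have 2: "diffop phi n (P \<circ> comm Q a)" for a
  proof (cases j)
    case 0
    then show ?thesis using Suc.prems by (auto simp: comm_mult_left comp_def klin_zero[OF kP] diffop_zero)
  next
    case (Suc j')
    then show ?thesis using Suc.hyps(1)[of i j' P "comm Q a"] Suc.hyps(2) Suc.prems
      by (simp add: diffop_Suc_comm)
  qed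
  have "diffop phi (Suc n) (P \<circ> Q)"
    using diffop_plus[OF 1 2] by (simp add: diffop_Suc_comm klin_comp[OF kP kQ] comm_comp[OF kP])
  then show ?case using Suc.hyps(2) by simp
qed

lemma symhom_thetaN:
  fixes phi :: "'k::comm_ring_1 \<Rightarrow> 'a::comm_ring_1"
  assumes "diffop phi n P" shows "symhom phi n (thetaN n P)"
  unfolding symhom_def
proof (intro conjI allI impI)
  show "thetaN n P xs = thetaN n P ys" if "mset xs = mset ys" for xs ys
    using thetaN_mset that .
next
  fix x y :: 'a and zs :: "'a list" and c assume n: "Suc (length zs) = n"
  then obtain m where m: "n = Suc m" "length zs = m" by blast
  have k: "klin phi P" using assms diffop_klin by blast
  show "thetaN n P ((x + y) # zs) = thetaN n P (x # zs) + thetaN n P (y # zs)"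
    "thetaN n P ((phi c * x) # zs) = phi c * thetaN n P (x # zs)"
    by (simp_all add: m thetaN_Cons_add[OF k] thetaN_Cons_scale[OF k])
  have "thetaN (Suc (Suc m)) P (x # y # zs) = 0"
    using thetaN_above[OF assms, of "Suc (Suc m)"] by (simp add: m)
  then show "thetaN n P ((x * y) # zs) = x * thetaN n P (y # zs) + y * thetaN n P (x # zs)"
    by (simp add: m thetaN_Cons_mult)
qed (simp add: thetaN_length)

section \<open>Derivations and Hasse--Schmidt derivations\<close>

lemma Der_klin: "d \<in> Der phi \<Longrightarrow> klin phi d"
  and Der_mult: "d \<in> Der phi \<Longrightarrow> d (x * y) = x * d y + y * d x"
  by (auto simp: Der_def)

lemma Der_plus: "d \<in> Der phi \<Longrightarrow> e \<in> Der phi \<Longrightarrow> (\<lambda>x. d x + e x) \<in> Der phi"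
  and Der_times: "d \<in> Der phi \<Longrightarrow> (\<lambda>x. a * d x) \<in> Der phi"
  and Der_zero: "(\<lambda>x. 0) \<in> Der phi"
  by (auto simp: Der_def klin_def algebra_simps)

lemma Der_sum: "(\<And>i. i \<in> I \<Longrightarrow> d i \<in> Der phi) \<Longrightarrow> (\<lambda>x. \<Sum>i\<in>I. d i x) \<in> Der phi"
  by (induction I rule: infinite_finite_induct) (auto simp: Der_zero intro: Der_plus)

lemma Der_one: "d \<in> Der phi \<Longrightarrow> d 1 = 0"
  using Der_mult[of d phi 1 1] by simp

lemma comm_Der: "d \<in> Der phi \<Longrightarrow> comm d a = (\<lambda>x. d a * x)"
  by (simp add: comm_def Der_mult algebra_simps)

lemma diffop_Der: "d \<in> Der phi \<Longrightarrow> diffop phi 1 d"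
  unfolding One_nat_def diffop_Suc_comm by (auto simp: Der_klin comm_Der)

lemma HS_0: "D \<in> HS phi \<Longrightarrow> D 0 = id"
  and HS_klin: "D \<in> HS phi \<Longrightarrow> klin phi (D i)"
  and HS_mult: "D \<in> HS phi \<Longrightarrow> D i (x * y) = (\<Sum>r\<le>i. D r x * D (i - r) y)"
  by (auto simp: HS_def)

lemma HS_Der: "D \<in> HS phi \<Longrightarrow> D 1 \<in> Der phi"
  by (auto simp: HS_def Der_def algebra_simps)

lemma IderI: "D \<in> HS phi \<Longrightarrow> D 1 = d \<Longrightarrow> d \<in> Ider phi"
  by (auto simp: Ider_def)

lemma Ider_Der: "Ider phi \<subseteq> Der phi"
  using HS_Der by (auto simp: Ider_def)

text \<open>Reparametrisation \<open>t \<mapsto> a * t\<close> of the generating series.\<close>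

lemma HS_times:
  assumes D: "D \<in> HS phi" shows "(\<lambda>i x. a ^ i * D i x) \<in> HS phi"
  unfolding HS_def
proof (intro CollectI conjI allI)
  show "(\<lambda>x. a ^ 0 * D 0 x) = id" using HS_0[OF D] by (simp add: fun_eq_iff)
  show "klin phi (\<lambda>x. a ^ i * D i x)" for i
    by (rule klin_times[OF HS_klin[OF D]])
  fix i x y
  have "a ^ i * (D r x * D (i - r) y) = a ^ r * D r x * (a ^ (i - r) * D (i - r) y)" if "r \<le> i" for r
  proof -
    have "a ^ i = a ^ r * a ^ (i - r)" using that by (simp flip: power_add)
    then show ?thesis by (simp add: ac_simps)
  qed
  then show "a ^ i * D i (x * y) = (\<Sum>r\<le>i. a ^ r * D r x * (a ^ (i - r) * D (i - r) y))"
    by (simp add: HS_mult[OF D] sum_distrib_left)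
qed

lemma Ider_times:
  assumes "d \<in> Ider phi" shows "(\<lambda>x. a * d x) \<in> Ider phi"
proof -
  from assms obtain D where D: "D \<in> HS phi" "d = D 1" by (auto simp: Ider_def)
  show ?thesis by (rule IderI[OF HS_times[OF D(1)]]) (simp add: D(2))
qed

text \<open>Both sides run over the quadruples \<open>(s, p, u, v)\<close> of total
  \<open>n\<close>, grouped by \<open>s + p = i\<close> on the left and by \<open>s + u = m\<close>
  on the right.\<close>

lemma sum_regroup:
  fixes F :: "nat \<Rightarrow> nat \<Rightarrow> nat \<Rightarrow> nat \<Rightarrow> 'b::comm_monoid_add"
  shows "(\<Sum>i\<le>n. \<Sum>s\<le>i. \<Sum>r\<le>n - i. F s (i - s) r (n - i - r)) =
    (\<Sum>m\<le>n. \<Sum>s\<le>m. \<Sum>p\<le>n - m. F s p (m - s) (n - m - p))"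
proof -
  have "(\<Sum>i\<le>n. \<Sum>s\<le>i. \<Sum>r\<le>n - i. F s (i - s) r (n - i - r)) =
    (\<Sum>(i, s, r)\<in>(SIGMA i:{..n}. {..i} \<times> {..n - i}). F s (i - s) r (n - i - r))"
    by (simp add: sum.Sigma sum.cartesian_product)
  also have "\<dots> = (\<Sum>(m, s, p)\<in>(SIGMA m:{..n}. {..m} \<times> {..n - m}). F s p (m - s) (n - m - p))"
    by (rule sum.reindex_bij_witness[where i = "\<lambda>(m, s, p). (s + p, s, m - s)"
          and j = "\<lambda>(i, s, r). (s + r, s, i - s)"]) (auto simp: algebra_simps)
  also have "\<dots> = (\<Sum>m\<le>n. \<Sum>s\<le>m. \<Sum>p\<le>n - m. F s p (m - s) (n - m - p))"
    by (simp add: sum.Sigma sum.cartesian_product)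
  finally show "(\<Sum>i\<le>n. \<Sum>s\<le>i. \<Sum>r\<le>n - i. F s (i - s) r (n - i - r)) =
    (\<Sum>m\<le>n. \<Sum>s\<le>m. \<Sum>p\<le>n - m. F s p (m - s) (n - m - p))" .
qed

text \<open>A Hasse--Schmidt derivation is a ring homomorphism from \<open>A\<close> to
  \<open>A[[t]]\<close> that is the identity at \<open>t = 0\<close>. Such maps compose after
  extension to \<open>A[[t]]\<close>, and their first terms add up.\<close>

lemma HS_comp:
  assumes D: "D \<in> HS phi" and E: "E \<in> HS phi"
  shows "(\<lambda>n x. \<Sum>i\<le>n. D i (E (n - i) x)) \<in> HS phi"
  unfolding HS_def
proof (intro CollectI conjI allI)
  show "(\<lambda>x. \<Sum>i\<le>0. D i (E (0 - i) x)) = id"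
    using HS_0[OF D] HS_0[OF E] by (simp add: fun_eq_iff)
  show "klin phi (\<lambda>x. \<Sum>i\<le>n. D i (E (n - i) x))" for n
    by (intro klin_sum_fun klin_comp[OF HS_klin[OF D] HS_klin[OF E], unfolded comp_def])
  fix n x y
  have "(\<Sum>i\<le>n. D i (E (n - i) (x * y))) =
    (\<Sum>i\<le>n. \<Sum>r\<le>n - i. \<Sum>s\<le>i. D s (E r x) * D (i - s) (E (n - i - r) y))"
    by (simp add: HS_mult[OF E] klin_sum[OF HS_klin[OF D]] HS_mult[OF D])
  also have "\<dots> = (\<Sum>i\<le>n. \<Sum>s\<le>i. \<Sum>r\<le>n - i. D s (E r x) * D (i - s) (E (n - i - r) y))"
    by (rule sum.cong[OF refl sum.swap])
  also have "\<dots> = (\<Sum>m\<le>n. \<Sum>s\<le>m. \<Sum>p\<le>n - m. D s (E (m - s) x) * D p (E (n - m - p) y))"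
    by (rule sum_regroup[of "\<lambda>s p r q. D s (E r x) * D p (E q y)"])
  also have "\<dots> = (\<Sum>m\<le>n. (\<Sum>s\<le>m. D s (E (m - s) x)) * (\<Sum>p\<le>n - m. D p (E (n - m - p) y)))"
    by (simp add: sum_product)
  finally show "(\<Sum>i\<le>n. D i (E (n - i) (x * y))) =
    (\<Sum>m\<le>n. (\<Sum>s\<le>m. D s (E (m - s) x)) * (\<Sum>p\<le>n - m. D p (E (n - m - p) y)))" .
qed

lemma Ider_plus:
  assumes "d \<in> Ider phi" "e \<in> Ider phi"
  shows "(\<lambda>x. d x + e x) \<in> Ider phi"
proof -
  from assms obtain D E where D: "D \<in> HS phi" "d = D 1" and E: "E \<in> HS phi" "e = E 1"
    by (auto simp: Ider_def)
  show ?thesis by (rule IderI[OF HS_comp[OF D(1) E(1)]])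
      (simp add: fun_eq_iff D(2) E(2) HS_0[OF D(1)] HS_0[OF E(1)] add.commute)
qed

lemma Ider_zero: "(\<lambda>x. 0) \<in> Ider phi"
proof -
  have "(\<lambda>i x. if i = 0 then x else 0) \<in> HS phi"
    by (auto simp: HS_def klin_def fun_eq_iff if_distrib if_distribR sum.delta cong: if_cong)
  then show ?thesis by (rule IderI) simp
qed

lemma Ider_sum: "(\<And>i. i \<in> I \<Longrightarrow> d i \<in> Ider phi) \<Longrightarrow> (\<lambda>x. \<Sum>i\<in>I. d i x) \<in> Ider phi"
  by (induction I rule: infinite_finite_induct) (auto simp: Ider_zero intro: Ider_plus)

lemma comm_HS:
  assumes "D \<in> HS phi"
  shows "comm (D n) a = (\<lambda>x. \<Sum>r<n. D (Suc r) a * D (n - Suc r) x)"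
  by (simp add: comm_def HS_mult[OF assms] HS_0[OF assms] lessThan_Suc_atMost[symmetric]
      sum.lessThan_Suc_shift del: sum.lessThan_Suc)

lemma diffop_HS:
  assumes "D \<in> HS phi" shows "diffop phi n (D n)"
proof (induction n rule: less_induct)
  case (less n)
  show ?case
  proof (cases n)
    case 0
    then show ?thesis using HS_0[OF assms] by (auto simp: fun_eq_iff intro: exI[of _ 1])
  next
    case (Suc m)
    have "diffop phi m (\<lambda>x. \<Sum>r<n. D (Suc r) a * D (n - Suc r) x)" for a
      using Suc by (intro diffop_sum diffop_times diffop_mono[OF less.IH]) auto
    then show ?thesis using HS_klin[OF assms] Suc by (simp add: diffop_Suc_comm comm_HS[OF assms])
  qed
qed

text \<open>In the commutator of \<open>D n\<close> with \<open>x\<close> only the term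
  \<open>D 1 x * D (n - 1)\<close> has enough order to survive. Hence the symbol depends on
  \<open>D 1\<close> alone, which makes the choice in \<open>hsop\<close> harmless.\<close>

lemma thetaN_HS:
  assumes D: "D \<in> HS phi"
  shows "thetaN n (D n) xs = (if length xs = n then \<Prod>x\<leftarrow>xs. D 1 x else 0)"
proof (induction xs arbitrary: n)
  case Nil
  then show ?case using HS_0[OF D] by (cases n) (auto simp: thetaN_0 thetaN_length)
next
  case (Cons x xs)
  show ?case
  proof (cases n)
    case (Suc m)
    have z: "thetaN m (D (m - Suc r)) xs = 0" if "r < m" for r
      using thetaN_above[OF diffop_HS[OF D], of "m - Suc r" m] that by simp
    have "thetaN n (D n) (x # xs) = (\<Sum>r<n. D (Suc r) x * thetaN m (D (n - Suc r)) xs)"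
      by (simp add: Suc thetaN_Suc comm_HS[OF D] thetaN_sum thetaN_plus thetaN_times)
    also have "\<dots> = D 1 x * thetaN m (D m) xs"
      unfolding Suc by (subst sum.lessThan_Suc_shift) (simp add: z)
    finally show ?thesis using Suc Cons.IH by simp
  qed (simp add: thetaN_length)
qed

section \<open>Surjectivity of theta implies integrability\<close>

definition theta_surj :: "('k::comm_ring_1 \<Rightarrow> 'a::comm_ring_1) \<Rightarrow> bool" where
  "theta_surj phi \<longleftrightarrow> (\<forall>n u. symhom phi n u \<longrightarrow> (\<exists>P. diffop phi n P \<and> thetaN n P = u))"

text \<open>The hypotheses on G say that it behaves like the family of all iterated commutators
  thetaN m P, m \<open>\<ge>\<close> 2, of an operator P.  Its top degree part is a multiderivation, hence the
  symbol of some P; subtracting the commutators of P lowers the degree.\<close>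
lemma commutator_family_lift:
  fixes phi :: "'k::comm_ring_1 \<Rightarrow> 'a::comm_ring_1" and G :: "'a list \<Rightarrow> 'a"
  assumes surj: "theta_surj phi"
    and mset: "\<And>xs ys. mset xs = mset ys \<Longrightarrow> G xs = G ys"
    and add: "\<And>x y zs. zs \<noteq> [] \<Longrightarrow> G ((x + y) # zs) = G (x # zs) + G (y # zs)"
    and scale: "\<And>c x zs. zs \<noteq> [] \<Longrightarrow> G ((phi c * x) # zs) = phi c * G (x # zs)"
    and mult: "\<And>x y zs. zs \<noteq> [] \<Longrightarrow>
      G ((x * y) # zs) = x * G (y # zs) + y * G (x # zs) + G (x # y # zs)"
    and high: "\<And>xs. n < length xs \<Longrightarrow> G xs = 0"
  shows "\<exists>P. klin phi P \<and> (\<forall>xs. 2 \<le> length xs \<longrightarrow> thetaN (length xs) P xs = G xs)"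
  using mset add scale mult high
proof (induction n arbitrary: G)
  case 0
  have "G xs = 0" if "2 \<le> length xs" for xs by (rule 0(5)) (use that in linarith)
  then show ?case by (intro exI[of _ "\<lambda>x. 0"]) (simp add: klin_zero_fun thetaN_zero)
next
  case (Suc n)
  note mset = Suc.prems(1) and add = Suc.prems(2) and scale = Suc.prems(3) and mult = Suc.prems(4)
    and high = Suc.prems(5)
  show ?case
  \<comment> \<open>For \<open>n = 0\<close> all words of length at least 2 have value 0, and
    shorter ones are unconstrained, so \<open>P = 0\<close> serves. For \<open>n > 0\<close> the
    longest words have a nonempty tail, as the hypotheses on \<open>G\<close> require.\<close>
  proof (cases n)
    case 0
    have "G xs = 0" if "2 \<le> length xs" for xs by (rule high) (use that 0 in linarith)
    then show ?thesis by (intro exI[of _ "\<lambda>x. 0"]) (simp add: klin_zero_fun thetaN_zero)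
  next
    case (Suc n')
    define u where "u = (\<lambda>xs. if length xs = Suc n then G xs else 0)"
    have "symhom phi (Suc n) u"
      unfolding symhom_def
    proof (intro conjI allI impI)
      fix xs ys :: "'a list" assume "length xs = Suc n" "mset xs = mset ys"
      then show "u xs = u ys" using mset[of xs ys] by (metis u_def size_mset)
    next
      fix x y c and zs :: "'a list" assume l: "Suc (length zs) = Suc n"
      then have "zs \<noteq> []" using Suc by auto
      moreover have "G (x # y # zs) = 0" using l high by simp
      ultimately show "u ((x + y) # zs) = u (x # zs) + u (y # zs)"
        "u ((phi c * x) # zs) = phi c * u (x # zs)"
        "u ((x * y) # zs) = x * u (y # zs) + y * u (x # zs)"
        using l add scale mult by (auto simp: u_def)
    qed (simp add: u_def)
    then obtain P where P: "diffop phi (Suc n) P" "thetaN (Suc n) P = u"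
      using surj unfolding theta_surj_def by blast
    have k: "klin phi P" using P(1) diffop_klin by blast
    let ?G = "\<lambda>xs. G xs - thetaN (length xs) P xs"
    have "\<exists>Q. klin phi Q \<and> (\<forall>xs. 2 \<le> length xs \<longrightarrow> thetaN (length xs) Q xs = ?G xs)"
    proof (rule Suc.IH)
      show "?G xs = ?G ys" if "mset xs = mset ys" for xs ys :: "'a list"
        using mset[OF that] thetaN_mset[OF that] that by (metis size_mset)
      show "?G xs = 0" if n: "n < length xs" for xs :: "'a list"
      proof (cases "length xs = Suc n")
        case True
        then show ?thesis using P(2) by (simp add: u_def)
      next
        case False
        then have "Suc n < length xs" using n by simp
        then show ?thesis using high thetaN_above[OF P(1)] by simp
      qed
    next
      fix x y c and zs :: "'a list" assume zs: "zs \<noteq> []"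
      show "?G ((x + y) # zs) = ?G (x # zs) + ?G (y # zs)"
        by (simp add: add[OF zs] thetaN_Cons_add[OF k])
      show "?G ((phi c * x) # zs) = phi c * ?G (x # zs)"
        by (simp add: scale[OF zs] thetaN_Cons_scale[OF k] right_diff_distrib)
      show "?G ((x * y) # zs) = x * ?G (y # zs) + y * ?G (x # zs) + ?G (x # y # zs)"
        by (simp add: mult[OF zs] thetaN_Cons_mult algebra_simps)
    qed
    then obtain Q where Q: "klin phi Q"
      "\<And>xs. 2 \<le> length xs \<Longrightarrow> thetaN (length xs) Q xs = G xs - thetaN (length xs) P xs"
      by blast
    show ?thesis
      by (rule exI[of _ "\<lambda>x. P x + Q x"]) (simp add: klin_plus k Q thetaN_plus)
  qed
qed

section \<open>Prolonging a Hasse--Schmidt derivation term by term\<close>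

unbundle fps_syntax

lemma fps_mult_nth_eq_0:
  fixes f g :: "'a::comm_ring_1 fps"
  assumes "\<And>i. i < a \<Longrightarrow> f $ i = 0" "\<And>i. i < b \<Longrightarrow> g $ i = 0" "i < a + b"
  shows "(f * g) $ i = 0"
  unfolding fps_mult_nth
proof (rule sum.neutral, rule ballI)
  fix j assume "j \<in> {0..i}"
  then have "j < a \<or> i - j < b" using assms(3) by auto
  then show "f $ j * g $ (i - j) = 0" using assms(1,2) by auto
qed

lemma fps_prod_list_nth_eq_0:
  fixes f :: "'b \<Rightarrow> 'a::comm_ring_1 fps"
  assumes "\<And>x. f x $ 0 = 0" "i < length xs"
  shows "(\<Prod>x\<leftarrow>xs. f x) $ i = 0"
  using assms(2)
proof (induction xs arbitrary: i)
  case (Cons x xs)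
  have "(f x * (\<Prod>x\<leftarrow>xs. f x)) $ i = 0"
    by (rule fps_mult_nth_eq_0[where a = 1 and b = "length xs"]) (use Cons assms(1) in auto)
  then show ?case by simp
qed simp

lemma sum_atMost_ends:
  fixes f :: "nat \<Rightarrow> 'a::comm_monoid_add"
  shows "0 < i \<Longrightarrow> (\<Sum>r\<le>i. f r) = f 0 + f i + (\<Sum>r\<in>{0<..<i}. f r)"
proof -
  assume "0 < i"
  then have "{..i} = insert 0 (insert i {0<..<i})" by auto
  then show ?thesis using \<open>0 < i\<close> by (simp add: add.assoc)
qed

text \<open>The iterated commutators of the sought operator are forced: they are the coefficients of
  \<open>t\<^sup>n\<^sup>+\<^sup>1\<close> in products of the truncated series F x = \<open>D\<^sub>1(x) t + \<dots> + D\<^sub>n(x) t\<^sup>n\<close>.\<close>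
lemma HS_extend:
  fixes phi :: "'k::comm_ring_1 \<Rightarrow> 'a::comm_ring_1"
  assumes surj: "theta_surj phi"
    and D0: "D 0 = id"
    and klin: "\<And>i. i \<le> n \<Longrightarrow> klin phi (D i)"
    and leib: "\<And>i x y. i \<le> n \<Longrightarrow> D i (x * y) = (\<Sum>r\<le>i. D r x * D (i - r) y)"
  shows "\<exists>P. klin phi P \<and>
    (\<forall>x y. P (x * y) = x * P y + y * P x + (\<Sum>r\<in>{0<..<Suc n}. D r x * D (Suc n - r) y))"
proof -
  define F where "F = (\<lambda>x. Abs_fps (\<lambda>i. if 0 < i \<and> i \<le> n then D i x else 0))"
  have F_nth: "F x $ i = (if 0 < i \<and> i \<le> n then D i x else 0)" for x i
    by (simp add: F_def)
  define G where "G = (\<lambda>xs. (\<Prod>x\<leftarrow>xs. F x) $ Suc n)"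
  have FF: "(F x * F y) $ i = (\<Sum>r\<in>{0<..<i}. D r x * D (i - r) y)" if "0 < i" "i \<le> Suc n" for x y i
  proof -
    have "(F x * F y) $ i = (\<Sum>r\<in>{0<..<i}. F x $ r * F y $ (i - r))"
      unfolding fps_mult_nth atLeast0AtMost by (subst sum_atMost_ends) (auto simp: F_nth that)
    also have "\<dots> = (\<Sum>r\<in>{0<..<i}. D r x * D (i - r) y)"
      by (rule sum.cong) (use that in \<open>auto simp: F_nth\<close>)
    finally show ?thesis .
  qed
  have Fadd: "F (x + y) = F x + F y" for x y
    by (rule fps_ext) (auto simp: F_nth klin_add[OF klin])
  have Fscale: "F (phi c * x) = fps_const (phi c) * F x" for c x
    by (rule fps_ext) (auto simp: F_nth klin_scale[OF klin])
  \<comment> \<open>A complete series \<open>x + F x\<close> would be multiplicative in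
    \<open>x\<close>. Because of the truncation the defect \<open>R x y\<close> starts at
    \<open>t^(n+1)\<close>; times one more series without constant term it misses the coefficient
    \<open>Suc n\<close>. This is the reason for the condition
    \<open>zs \<noteq> []\<close>.\<close>
  define R where "R = (\<lambda>x y. F (x * y) - (fps_const x * F y + fps_const y * F x + F x * F y))"
  have R: "R x y $ i = 0" if "i < Suc n" for x y i
  proof (cases "i = 0")
    case True
    then show ?thesis by (simp add: R_def F_nth)
  next
    case False
    then have i: "0 < i" "i \<le> n" using that by auto
    show ?thesis using i
      by (simp add: R_def F_nth FF leib sum_atMost_ends[OF i(1)] D0)
  qed
  have "\<exists>P. klin phi P \<and> (\<forall>xs. 2 \<le> length xs \<longrightarrow> thetaN (length xs) P xs = G xs)"
  proof (rule commutator_family_lift[OF surj, where n = "Suc n"])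
    fix xs ys :: "'a list" assume "mset xs = mset ys"
    then have "prod_mset (image_mset F (mset xs)) = prod_mset (image_mset F (mset ys))" by simp
    then show "G xs = G ys" unfolding G_def by (simp add: prod_mset_prod_list flip: mset_map)
  next
    fix xs :: "'a list" assume "Suc n < length xs"
    then show "G xs = 0" unfolding G_def by (intro fps_prod_list_nth_eq_0) (auto simp: F_nth)
  next
    fix x y and zs :: "'a list" assume "zs \<noteq> []"
    then have Z: "(\<Prod>z\<leftarrow>zs. F z) $ 0 = 0" by (intro fps_prod_list_nth_eq_0) (auto simp: F_nth)
    have "(R x y * (\<Prod>z\<leftarrow>zs. F z)) $ Suc n = 0"
      by (rule fps_mult_nth_eq_0[where a = "Suc n" and b = 1]) (use R Z in auto)
    moreover have "F (x * y) = fps_const x * F y + fps_const y * F x + F x * F y + R x y"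
      by (simp add: R_def)
    ultimately show "G ((x * y) # zs) = x * G (y # zs) + y * G (x # zs) + G (x # y # zs)"
      by (simp add: G_def distrib_right mult.assoc)
  qed (simp_all add: G_def Fadd Fscale distrib_right mult.assoc)
  then obtain P where P: "klin phi P" "\<And>xs. 2 \<le> length xs \<Longrightarrow> thetaN (length xs) P xs = G xs"
    by blast
  \<comment> \<open>The two-letter commutator contains the extra term \<open>x * y * P 1\<close>.
    Subtracting the multiplication by \<open>P 1\<close> removes it and changes no
    commutator.\<close>
  show ?thesis
  proof (intro exI[of _ "\<lambda>x. P x - P 1 * x"] conjI allI)
    show "klin phi (\<lambda>x. P x - P 1 * x)"
      by (rule klin_subtract[OF P(1) klin_mult_left])
    fix x y
    have "thetaN 2 P [x, y] = (\<Sum>r\<in>{0<..<Suc n}. D r x * D (Suc n - r) y)"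
      using P(2)[of "[x, y]"] FF[of "Suc n" x y] by (simp add: G_def numeral_2_eq_2)
    moreover have "thetaN 2 P [x, y] = P (x * y) - x * P y - y * P x + x * y * P 1"
      by (simp add: numeral_2_eq_2 thetaN_Suc thetaN_0 comm_def algebra_simps)
    ultimately show "P (x * y) - P 1 * (x * y) = x * (P y - P 1 * y) + y * (P x - P 1 * x) +
        (\<Sum>r\<in>{0<..<Suc n}. D r x * D (Suc n - r) y)"
      by (simp add: algebra_simps)
  qed
qed

text \<open>A prolongation by one term is not unique, so the infinite sequence is obtained by
  dependent choice among compatible truncations.\<close>

lemma theta_surj_imp_Ider_eq_Der:
  fixes phi :: "'k::comm_ring_1 \<Rightarrow> 'a::comm_ring_1"
  assumes surj: "theta_surj phi"
  shows "Ider phi = Der phi"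
proof
  show "Der phi \<subseteq> Ider phi"
  proof
    fix d assume d: "d \<in> Der phi"
    \<comment> \<open>A Hasse--Schmidt derivation up to index \<open>n + 1\<close>, arbitrary beyond
      it. The offset lets stage 0 be \<open>d\<close> itself.\<close>
    define T where "T = (\<lambda>n (D :: nat \<Rightarrow> 'a \<Rightarrow> 'a). D 0 = id \<and> D 1 = d \<and>
      (\<forall>i\<le>Suc n. klin phi (D i) \<and> (\<forall>x y. D i (x * y) = (\<Sum>r\<le>i. D r x * D (i - r) y))))"
    define Q where "Q = (\<lambda>n (D :: nat \<Rightarrow> 'a \<Rightarrow> 'a) D'. \<forall>i\<le>Suc n. D' i = D i)"
    have "\<exists>f. \<forall>n. T n (f n) \<and> Q n (f n) (f (Suc n))"
    proof (rule dependent_nat_choice)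
      have "T 0 (\<lambda>i. if i = 0 then id else d)"
        using Der_klin[OF d] Der_mult[OF d] klin_mult_left[of phi 1]
        by (auto simp: T_def le_Suc_eq id_def mult.commute)
      then show "\<exists>D. T 0 D" by blast
    next
      fix D n assume T: "T n D"
      then have T': "D 0 = id" "D 1 = d" "\<And>i. i \<le> Suc n \<Longrightarrow> klin phi (D i)"
        "\<And>i x y. i \<le> Suc n \<Longrightarrow> D i (x * y) = (\<Sum>r\<le>i. D r x * D (i - r) y)"
        by (auto simp: T_def)
      obtain P where P: "klin phi P" "\<And>x y. P (x * y) =
          x * P y + y * P x + (\<Sum>r\<in>{0<..<Suc (Suc n)}. D r x * D (Suc (Suc n) - r) y)"
        using HS_extend[OF surj T'(1,3,4)] by blast
      define E where "E = D(Suc (Suc n) := P)"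
      have E: "E i = D i" if "i \<le> Suc n" for i using that by (simp add: E_def)
      have "E i (x * y) = (\<Sum>r\<le>i. E r x * E (i - r) y)" if i: "i \<le> Suc (Suc n)" for i x y
      proof (cases "i \<le> Suc n")
        case True
        then show ?thesis using T'(4) by (simp add: E)
      next
        case False
        then have i: "i = Suc (Suc n)" using that by simp
        have "(\<Sum>r\<in>{0<..<i}. E r x * E (i - r) y) = (\<Sum>r\<in>{0<..<i}. D r x * D (i - r) y)"
          by (rule sum.cong) (auto simp: E i)
        moreover have "E 0 = id" "E i = P" using T'(1) by (simp_all add: E_def i)
        moreover have "(\<Sum>r\<le>i. E r x * E (i - r) y) =
            E 0 x * E i y + E i x * E 0 y + (\<Sum>r\<in>{0<..<i}. E r x * E (i - r) y)"
          by (subst sum_atMost_ends) (simp_all add: i)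
        ultimately show ?thesis
          using P(2)[of x y] by (simp add: i mult.commute)
      qed
      moreover have "klin phi (E i)" if i: "i \<le> Suc (Suc n)" for i
        using that P(1) T'(3) by (auto simp: E_def le_Suc_eq)
      moreover have "E 0 = id" "E 1 = d" using T'(1,2) by (simp_all add: E_def)
      ultimately have "T (Suc n) E" by (simp add: T_def)
      moreover have "Q n D E" by (simp add: Q_def E)
      ultimately show "\<exists>E. T (Suc n) E \<and> Q n D E" by blast
    qed
    then obtain f where f: "\<And>n. T n (f n)" "\<And>n. Q n (f n) (f (Suc n))" by blast
    \<comment> \<open>By \<open>Q\<close> the entry with index \<open>i\<close> no longer changes
      from stage \<open>i\<close> on, so the diagonal agrees with all later stages.\<close>
    define H where "H = (\<lambda>i. f i i)"
    have H: "f m i = H i" if "i \<le> m" for m i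
      using that
    proof (induction m rule: dec_induct)
      case (step m)
      then show ?case using f(2)[of m] by (simp add: Q_def)
    qed (simp add: H_def)
    have fT: "f n 0 = id" "f n 1 = d" "i \<le> Suc n \<Longrightarrow> klin phi (f n i)"
      "i \<le> Suc n \<Longrightarrow> f n i (x * y) = (\<Sum>r\<le>i. f n r x * f n (i - r) y)" for n i x y
      using f(1)[of n] by (auto simp: T_def)
    have "H \<in> HS phi"
      unfolding HS_def
    proof (intro CollectI conjI allI)
      show "H 0 = id" using fT(1)[of 0] by (simp add: H_def)
      show "klin phi (H i)" for i using fT(3)[of i i] by (simp add: H_def)
      fix i x y
      show "H i (x * y) = (\<Sum>r\<le>i. H r x * H (i - r) y)"
        using fT(4)[of i i x y] by (simp add: H)
    qed
    moreover have "H 1 = d" using fT(2)[of 1] by (simp add: H_def)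
    ultimately show "d \<in> Ider phi" by (rule IderI)
  qed
qed (rule Ider_Der)

section \<open>Operators attached to monomials\<close>

lemma hsop_HS:
  assumes "d \<in> Ider phi" shows "hsop phi d \<in> HS phi" "hsop phi d 1 = d"
proof -
  have "\<exists>D. D \<in> HS phi \<and> D 1 = d" using assms by (auto simp: Ider_def)
  moreover have "hsop phi d = (SOME D. D \<in> HS phi \<and> D 1 = d)"
    by (rule ext) (simp add: hsop_def)
  ultimately show "hsop phi d \<in> HS phi" "hsop phi d 1 = d"
    using someI_ex[of "\<lambda>D. D \<in> HS phi \<and> D 1 = d"] by simp_all
qed

text \<open>\<open>mono_op\<close> uses an unknown ordering of the monomial; an explicit list admits
  induction, and the symbol will turn out not to see the ordering.\<close>

definition list_op :: "('k::comm_ring_1 \<Rightarrow> 'a::comm_ring_1) \<Rightarrow> (('a \<Rightarrow> 'a) \<times> nat) list \<Rightarrow> 'a \<Rightarrow> 'a" where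
  "list_op phi xs = foldr (\<lambda>(d, j) Q. hsop phi d j \<circ> Q) xs id"

lemma list_op_Nil: "list_op phi [] = id"
  and list_op_Cons: "list_op phi ((d, j) # xs) = hsop phi d j \<circ> list_op phi xs"
  by (simp_all add: list_op_def)

lemma mono_op_eq_list_op: "\<exists>xs. mset xs = m \<and> mono_op phi m = list_op phi xs"
  using someI_ex[OF ex_mset[of m]] by (auto simp: mono_op_def list_op_def)

lemma list_op_degree_0:
  assumes "fst ` set xs \<subseteq> Ider phi" "(\<Sum>v\<leftarrow>xs. snd v) = 0"
  shows "list_op phi xs = id"
  using assms
proof (induction xs)
  case (Cons v xs)
  then have "snd v = 0" "fst v \<in> Ider phi" "list_op phi xs = id" by auto
  then show ?case by (cases v) (simp add: list_op_Cons HS_0[OF hsop_HS(1)])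
qed (simp add: list_op_Nil)

text \<open>All factors but one are \<open>D 0 = id\<close>, so the composite is an integrable
  derivation exactly, not only modulo lower order.\<close>

lemma list_op_degree_1:
  assumes "fst ` set xs \<subseteq> Ider phi" "(\<Sum>v\<leftarrow>xs. snd v) = 1"
  shows "list_op phi xs \<in> Ider phi"
  using assms
proof (induction xs)
  case (Cons v xs)
  obtain d j where v: "v = (d, j)" by fastforce
  have d: "d \<in> Ider phi" using Cons.prems v by auto
  show ?case
  proof (cases "j = 0")
    case True
    then show ?thesis using Cons v HS_0[OF hsop_HS(1)[OF d]] by (simp add: list_op_Cons)
  next
    case False
    have "j + (\<Sum>v\<leftarrow>xs. snd v) = 1" using Cons.prems(2) v by simp
    with False have j: "j = 1" and 0: "(\<Sum>v\<leftarrow>xs. snd v) = 0" by linarith+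
    have "list_op phi xs = id" using Cons.prems(1) 0 by (intro list_op_degree_0) auto
    then show ?thesis using d hsop_HS(2)[OF d] by (simp add: v j list_op_Cons)
  qed
qed simp

lemma gdeg_mset: "gdeg (mset xs) = (\<Sum>v\<leftarrow>xs. snd v)"
  by (simp add: gdeg_def sum_mset_sum_list flip: mset_map)

lemma gpoly_over_keys: "gpoly_over N f \<Longrightarrow> m \<in> Poly_Mapping.keys f \<Longrightarrow> fst ` set_mset m \<subseteq> N"
  by (auto simp: gpoly_over_def)

text \<open>Surjectivity in degree 1 writes a derivation as an \<open>A\<close>-combination of
  integrable ones plus a multiplication. Derivations kill 1, so the multiplication is zero.\<close>

lemma vartheta_iso_imp_Ider_eq_Der:
  assumes "vartheta_iso phi" shows "Ider phi = Der phi"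
proof
  show "Der phi \<subseteq> Ider phi"
  proof
    fix d assume d: "d \<in> Der phi"
    obtain f where f: "gpoly_over (Ider phi) f" "ghomog 1 f"
      "lowerord phi 1 (\<lambda>x. d x - varthetaP phi f x)"
      using assms diffop_Der[OF d] unfolding vartheta_iso_def by blast
    have "mono_op phi m \<in> Ider phi" if m: "m \<in> Poly_Mapping.keys f" for m
    proof -
      obtain xs where xs: "mset xs = m" "mono_op phi m = list_op phi xs"
        using mono_op_eq_list_op by blast
      have "gdeg m = 1" using f(2) m by (auto simp: ghomog_def)
      then show ?thesis using gpoly_over_keys[OF f(1) m]
        unfolding xs(2) by (intro list_op_degree_1) (auto simp: gdeg_mset simp flip: xs(1))
    qed
    then have v: "varthetaP phi f \<in> Ider phi"
      unfolding varthetaP_def by (intro Ider_sum Ider_times)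
    have "diffop phi 0 (\<lambda>x. d x - varthetaP phi f x)" using f(3) by (simp add: lowerord_def)
    then obtain a where a: "d x - varthetaP phi f x = a * x" for x by (auto simp: fun_eq_iff)
    have "varthetaP phi f 1 = 0" using v Ider_Der Der_one by blast
    then have "a = 0" using a[of 1] Der_one[OF d] by simp
    then have "d = varthetaP phi f" using a by (simp add: fun_eq_iff)
    then show "d \<in> Ider phi" using v by simp
  qed
qed (rule Ider_Der)

section \<open>The shuffle algebra\<close>

text \<open>A word \<open>x\<^sub>1 \<dots> x\<^sub>n\<close> stands for the monomial \<open>dx\<^sub>1 \<dots> dx\<^sub>n\<close>, so the paper's \<open>\<star>\<close> is the restriction of
  the product below to symmetric multiderivations.\<close>

typedef 'a shuf = "UNIV :: ('a list \<Rightarrow> 'a) set" morphisms shuf_nth Shuf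
  by simp

lemma shuf_nth_Shuf [simp]: "shuf_nth (Shuf u) = u"
  by (simp add: Shuf_inverse)

lemma shuf_eqI: "(\<And>xs. shuf_nth u xs = shuf_nth v xs) \<Longrightarrow> u = v"
  by (metis ext shuf_nth_inject)

text \<open>Deciding whether the first letter goes to \<open>u\<close> or to \<open>v\<close>
  unfolds the sum over subsets. Being defined on all functions on words, symmetric or not, the
  product satisfies its ring laws by induction on the word.\<close>

fun shuffle :: "('a list \<Rightarrow> 'a) \<Rightarrow> ('a list \<Rightarrow> 'a) \<Rightarrow> 'a list \<Rightarrow> 'a::comm_ring_1" where
  "shuffle u v [] = u [] * v []"
| "shuffle u v (x # xs) = shuffle (\<lambda>ys. u (x # ys)) v xs + shuffle u (\<lambda>ys. v (x # ys)) xs"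

lemma shuffle_add_left: "shuffle (\<lambda>xs. u xs + v xs) w xs = shuffle u w xs + shuffle v w xs"
  by (induction xs arbitrary: u v w) (simp_all add: algebra_simps)

lemma shuffle_scale_left: "shuffle (\<lambda>xs. a * u xs) v xs = a * shuffle u v xs"
  by (induction xs arbitrary: u v) (simp_all add: algebra_simps)

lemma shuffle_commute: "shuffle u v xs = shuffle v u xs"
  by (induction xs arbitrary: u v) (simp_all add: mult.commute add.commute)

lemma shuffle_add_right: "shuffle u (\<lambda>xs. v xs + w xs) xs = shuffle u v xs + shuffle u w xs"
  by (simp add: shuffle_commute[of u] shuffle_add_left)

lemma shuffle_assoc: "shuffle (shuffle u v) w xs = shuffle u (shuffle v w) xs"
  by (induction xs arbitrary: u v w)
    (simp_all add: mult.assoc shuffle_add_left shuffle_add_right add.assoc)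

lemma shuffle_zero_left: "shuffle (\<lambda>xs. 0) v xs = 0"
  using shuffle_scale_left[of 0 "\<lambda>xs. 0" v xs] by simp

lemma shuffle_one_left: "shuffle (\<lambda>xs. if xs = [] then a else 0) v xs = a * v xs"
  by (induction xs arbitrary: v) (simp_all add: shuffle_zero_left)

instantiation shuf :: (comm_ring_1) comm_ring_1
begin

definition "0 = Shuf (\<lambda>xs. 0)"
definition "1 = Shuf (\<lambda>xs. if xs = [] then 1 else 0)"
definition "u + v = Shuf (\<lambda>xs. shuf_nth u xs + shuf_nth v xs)"
definition "- u = Shuf (\<lambda>xs. - shuf_nth u xs)"
definition "u - v = Shuf (\<lambda>xs. shuf_nth u xs - shuf_nth v xs)"
definition "u * v = Shuf (shuffle (shuf_nth u) (shuf_nth v))"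

instance
proof
  fix u v w :: "'a shuf"
  show "u * v * w = u * (v * w)"
    by (rule shuf_eqI) (simp add: times_shuf_def shuffle_assoc)
  show "u * v = v * u"
    by (rule shuf_eqI) (simp add: times_shuf_def shuffle_commute[of "shuf_nth u"])
  show "1 * u = u"
    by (rule shuf_eqI) (simp add: times_shuf_def one_shuf_def shuffle_one_left)
  show "(u + v) * w = u * w + v * w"
    by (rule shuf_eqI) (simp add: times_shuf_def plus_shuf_def shuffle_add_left)
  show "(0 :: 'a shuf) \<noteq> 1"
  proof
    assume "(0 :: 'a shuf) = 1"
    then have "shuf_nth (0 :: 'a shuf) [] = shuf_nth 1 []" by (rule arg_cong)
    then show False by (simp add: zero_shuf_def one_shuf_def)
  qed
qed (auto intro!: shuf_eqI simp: zero_shuf_def plus_shuf_def uminus_shuf_def minus_shuf_def algebra_simps)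

end

lemma shuf_nth_simps [simp]:
  "shuf_nth 0 xs = 0"
  "shuf_nth 1 xs = (if xs = [] then 1 else 0)"
  "shuf_nth (u + v) xs = shuf_nth u xs + shuf_nth v xs"
  "shuf_nth (- u) xs = - shuf_nth u xs"
  "shuf_nth (u - v) xs = shuf_nth u xs - shuf_nth v xs"
  by (simp_all add: zero_shuf_def one_shuf_def plus_shuf_def uminus_shuf_def minus_shuf_def)

lemma shuf_nth_sum: "shuf_nth (\<Sum>i\<in>I. u i) xs = (\<Sum>i\<in>I. shuf_nth (u i) xs)"
  by (induction I rule: infinite_finite_induct) auto

text \<open>A partial derivative: it is a derivation of the shuffle product, it takes the symbol of
  \<open>P\<close> to that of \<open>comm P x\<close>, and together with the value on the empty word
  it determines an element.\<close>

definition shift :: "'a \<Rightarrow> 'a shuf \<Rightarrow> 'a shuf" where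
  "shift x u = Shuf (\<lambda>xs. shuf_nth u (x # xs))"

definition sconst :: "'a::comm_ring_1 \<Rightarrow> 'a shuf" where
  "sconst a = Shuf (\<lambda>xs. if xs = [] then a else 0)"

lemma shuf_nth_shift [simp]: "shuf_nth (shift x u) xs = shuf_nth u (x # xs)"
  by (simp add: shift_def)

lemma shuf_nth_sconst: "shuf_nth (sconst a) xs = (if xs = [] then a else 0)"
  by (simp add: sconst_def)

lemma shuf_nth_mult_Nil [simp]: "shuf_nth (u * v) [] = shuf_nth u [] * shuf_nth v []"
  by (simp add: times_shuf_def)

lemma shuf_nth_mult_Cons:
  "shuf_nth (u * v) (x # xs) = shuf_nth (shift x u * v) xs + shuf_nth (u * shift x v) xs"
  by (simp add: times_shuf_def shift_def)

lemma shuf_eq_iff: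
  "u = v \<longleftrightarrow> shuf_nth u [] = shuf_nth v [] \<and> (\<forall>x. shift x u = shift x v)"
proof
  assume *: "shuf_nth u [] = shuf_nth v [] \<and> (\<forall>x. shift x u = shift x v)"
  show "u = v"
  proof (rule shuf_eqI)
    show "shuf_nth u xs = shuf_nth v xs" for xs
      using * by (cases xs) (auto simp flip: shuf_nth_shift)
  qed
qed simp

lemma shift_simps [simp]:
  "shift x 0 = 0" "shift x (u + v) = shift x u + shift x v"
  "shift x (sconst a) = 0" "shift x 1 = 0"
  by (auto intro!: shuf_eqI simp: shuf_nth_sconst)

lemma shift_mult: "shift x (u * v) = shift x u * v + u * shift x v"
  by (rule shuf_eqI) (simp add: shuf_nth_mult_Cons)

lemma shift_sum: "shift x (\<Sum>i\<in>I. u i) = (\<Sum>i\<in>I. shift x (u i))"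
  by (induction I rule: infinite_finite_induct) auto

lemma shuf_nth_sconst_mult [simp]: "shuf_nth (sconst a * u) xs = a * shuf_nth u xs"
  by (simp add: times_shuf_def sconst_def shuffle_one_left)

lemma sconst_simps:
  "sconst 0 = 0" "sconst 1 = 1" "sconst (a + b) = sconst a + sconst b"
  "sconst (a * b) = sconst a * sconst b" "sconst (a ^ n) = sconst a ^ n"
proof -
  show 0: "sconst 0 = 0" "sconst 1 = 1" "sconst (a + b) = sconst a + sconst b"
    by (auto intro!: shuf_eqI simp: shuf_nth_sconst)
  show *: "sconst (a * b) = sconst a * sconst b" for a b
    by (auto intro!: shuf_eqI simp: shuf_nth_sconst)
  show "sconst (a ^ n) = sconst a ^ n"
    by (induction n) (simp_all add: * 0)
qed

lemma shift_sconst_mult: "shift x (sconst a * u) = sconst a * shift x u"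
  by (simp add: shift_mult)

definition shom :: "nat \<Rightarrow> 'a::comm_ring_1 shuf \<Rightarrow> bool" where
  "shom n u \<longleftrightarrow> (\<forall>xs. length xs \<noteq> n \<longrightarrow> shuf_nth u xs = 0)"

lemma shom_0: "shom n 0"
  and shom_add: "shom n u \<Longrightarrow> shom n v \<Longrightarrow> shom n (u + v)"
  and shom_sconst_mult: "shom n u \<Longrightarrow> shom n (sconst a * u)"
  and shom_1: "shom 0 1"
  by (auto simp: shom_def)

lemma shom_sum: "(\<And>i. i \<in> I \<Longrightarrow> shom n (u i)) \<Longrightarrow> shom n (\<Sum>i\<in>I. u i)"
  by (induction I rule: infinite_finite_induct) (auto intro: shom_add shom_0)

lemma shom_mult: "shom m u \<Longrightarrow> shom n v \<Longrightarrow> shom (m + n) (u * v)"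
proof -
  have "length xs \<noteq> m + n \<Longrightarrow> shom m u \<Longrightarrow> shom n v \<Longrightarrow> shuf_nth (u * v) xs = 0" for xs
  proof (induction xs arbitrary: m n u v)
    case Nil
    then have "m \<noteq> 0 \<or> n \<noteq> 0" by auto
    then show ?case using Nil by (auto simp: shom_def)
  next
    case (Cons x xs)
    have "shuf_nth (shift x u * v) xs = 0"
    proof (cases m)
      case 0
      then have "shift x u = 0" using Cons.prems(2) by (auto intro!: shuf_eqI simp: shom_def)
      then show ?thesis by simp
    next
      case (Suc k)
      have "shom k (shift x u)" using Cons.prems(2) Suc by (auto simp: shom_def)
      then show ?thesis using Cons.IH[of k n] Cons.prems Suc by simp
    qed
    moreover have "shuf_nth (u * shift x v) xs = 0"
    proof (cases n)
      case 0
      then have "shift x v = 0" using Cons.prems(3) by (auto intro!: shuf_eqI simp: shom_def)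
      then show ?thesis by simp
    next
      case (Suc k)
      have "shom k (shift x v)" using Cons.prems(3) Suc by (auto simp: shom_def)
      then show ?thesis using Cons.IH[of m k] Cons.prems Suc by simp
    qed
    ultimately show ?case by (simp add: shuf_nth_mult_Cons)
  qed
  then show "shom m u \<Longrightarrow> shom n v \<Longrightarrow> shom (m + n) (u * v)" by (auto simp: shom_def)
qed

subsection \<open>Divided powers\<close>

text \<open>The divided power of \<open>d\<close>, formed without division: the \<open>j\<close>-th
  shuffle power of \<open>dpow d 1\<close> is \<open>j!\<close> times this element.\<close>

definition dpow :: "('a::comm_ring_1 \<Rightarrow> 'a) \<Rightarrow> nat \<Rightarrow> 'a shuf" where
  "dpow d j = Shuf (\<lambda>xs. if length xs = j then \<Prod>x\<leftarrow>xs. d x else 0)"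

lemma shuf_nth_dpow_Nil [simp]: "shuf_nth (dpow d j) [] = (if j = 0 then 1 else 0)"
  by (simp add: dpow_def)

lemma shift_dpow: "shift x (dpow d j) = (if j = 0 then 0 else sconst (d x) * dpow d (j - 1))"
  by (rule shuf_eqI) (auto simp: dpow_def)

lemma dpow_0 [simp]: "dpow d 0 = 1"
  by (auto intro!: shuf_eqI simp: dpow_def)

lemma shom_dpow: "shom j (dpow d j)"
  by (simp add: shom_def dpow_def)

lemma sconst_of_nat: "of_nat n = sconst (of_nat n)"
  by (induction n) (simp_all add: sconst_simps)

lemma of_nat_shuf: "shuf_nth (of_nat c * u) xs = of_nat c * shuf_nth u xs"
  by (simp add: sconst_of_nat)

text \<open>Removing a letter extracts \<open>d x\<close> and lowers one of the two exponents, so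
  the coefficients obey Pascal's rule.\<close>

lemma dpow_mult: "dpow d i * dpow d j = of_nat ((i + j) choose i) * dpow d (i + j)"
proof -
  have "shuf_nth (dpow d i * dpow d j) xs = of_nat ((i + j) choose i) * shuf_nth (dpow d (i + j)) xs" for xs
  proof (induction xs arbitrary: i j)
    case (Cons x xs)
    have "shuf_nth (dpow d i * dpow d j) (x # xs) =
      shuf_nth (shift x (dpow d i) * dpow d j) xs + shuf_nth (dpow d i * shift x (dpow d j)) xs"
      by (rule shuf_nth_mult_Cons)
    also have "\<dots> = of_nat ((i + j) choose i) * shuf_nth (shift x (dpow d (i + j))) xs"
    proof (cases i; cases j)
      fix i' j' assume i: "i = Suc i'" "j = Suc j'"
      have "shuf_nth (shift x (dpow d i) * dpow d j) xs =
          d x * (of_nat ((i' + Suc j') choose i') * shuf_nth (dpow d (i' + Suc j')) xs)"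
        using Cons.IH[of i' j] by (simp add: i shift_dpow mult.assoc)
      moreover have "shuf_nth (dpow d i * shift x (dpow d j)) xs =
          d x * (of_nat ((Suc i' + j') choose Suc i') * shuf_nth (dpow d (Suc i' + j')) xs)"
        using Cons.IH[of i j'] by (simp add: i shift_dpow mult.left_commute[of _ "sconst _"])
      ultimately show ?thesis by (simp add: i shift_dpow algebra_simps)
    qed (simp_all add: shift_dpow)
    finally show ?case by (simp only: shuf_nth_shift)
  qed auto
  then show ?thesis by (intro shuf_eqI) (simp add: of_nat_shuf)
qed

lemma dpow_scale: "dpow (\<lambda>x. a * d x) j = sconst (a ^ j) * dpow d j"
proof -
  have "shuf_nth (dpow (\<lambda>x. a * d x) j) xs = shuf_nth (sconst (a ^ j) * dpow d j) xs" for xs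
  proof (induction xs arbitrary: j)
    case (Cons x xs)
    have "shuf_nth (shift x (dpow (\<lambda>x. a * d x) j)) xs = shuf_nth (shift x (sconst (a ^ j) * dpow d j)) xs"
      using Cons.IH[of "j - 1"] by (cases j)
        (simp_all add: shift_dpow shift_sconst_mult mult.assoc mult.left_commute[of "d x"])
    then show ?case by (simp only: shuf_nth_shift)
  qed (auto simp: sconst_simps)
  then show ?thesis by (rule shuf_eqI)
qed

text \<open>Both sides solve the same recursion: for \<open>n > 0\<close>, removing \<open>x\<close>
  leaves the element of degree \<open>n - 1\<close> times \<open>d x + e x\<close>.\<close>

lemma dpow_add: "dpow (\<lambda>x. d x + e x) n = (\<Sum>i\<le>n. dpow d i * dpow e (n - i))"
proof -
  have "shuf_nth (dpow (\<lambda>x. d x + e x) n) xs = shuf_nth (\<Sum>i\<le>n. dpow d i * dpow e (n - i)) xs" for xs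
  proof (induction xs arbitrary: n)
    case Nil
    have "(\<Sum>i\<le>n. shuf_nth (dpow d i * dpow e (n - i)) []) = 0" if "n \<noteq> 0"
      by (rule sum.neutral) (use that in auto)
    then show ?case by (cases "n = 0") (simp_all add: shuf_nth_sum)
  next
    case (Cons x xs)
    have "shuf_nth (shift x (dpow (\<lambda>x. d x + e x) n)) xs =
      shuf_nth (shift x (\<Sum>i\<le>n. dpow d i * dpow e (n - i))) xs"
    proof (cases n)
      case (Suc m)
      have "shift x (\<Sum>i\<le>n. dpow d i * dpow e (n - i)) =
          (\<Sum>i\<le>Suc m. shift x (dpow d i) * dpow e (Suc m - i)) +
          (\<Sum>i\<le>Suc m. dpow d i * shift x (dpow e (Suc m - i)))"
        by (simp only: Suc shift_sum shift_mult sum.distrib)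
      also have "(\<Sum>i\<le>Suc m. shift x (dpow d i) * dpow e (Suc m - i)) =
          sconst (d x) * (\<Sum>i\<le>m. dpow d i * dpow e (m - i))"
        by (subst sum.atMost_Suc_shift) (simp add: shift_dpow sum_distrib_left mult.assoc)
      also have "(\<Sum>i\<le>Suc m. dpow d i * shift x (dpow e (Suc m - i))) =
          sconst (e x) * (\<Sum>i\<le>m. dpow d i * dpow e (m - i))"
      proof -
        have "dpow d i * shift x (dpow e (Suc m - i)) = sconst (e x) * (dpow d i * dpow e (m - i))"
          if "i \<le> m" for i
          using that by (simp add: shift_dpow Suc_diff_le mult.left_commute)
        then show ?thesis by (simp add: sum_distrib_left)
      qed
      finally show ?thesis using Cons.IH[of m] by (simp add: Suc shift_dpow algebra_simps)
    qed simp
    then show ?case by (simp only: shuf_nth_shift)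
  qed
  then show ?thesis by (rule shuf_eqI)
qed

section \<open>Evaluating divided power polynomials\<close>

lemma poly_mapping_eq_sum_single:
  "f = (\<Sum>m\<in>Poly_Mapping.keys f. Poly_Mapping.single m (Poly_Mapping.lookup f m))"
  by (rule poly_mapping_eqI)
    (simp add: lookup_sum lookup_single when_def in_keys_iff sum.delta)

definition csym_mono :: "(('a::comm_ring_1 \<Rightarrow> 'a) \<times> nat) multiset \<Rightarrow> 'a shuf" where
  "csym_mono m = (\<Prod>(d, j)\<in>#m. dpow d j)"

text \<open>The canonical map from \<Gamma> to the shuffle algebra, on polynomial representatives.
  Unlike \<open>varthetaP\<close> it involves no choice of Hasse--Schmidt derivations and no order
  of composition.\<close>

definition csym :: "'a::comm_ring_1 gpoly \<Rightarrow> 'a shuf" where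
  "csym f = (\<Sum>m\<in>Poly_Mapping.keys f. sconst (Poly_Mapping.lookup f m) * csym_mono m)"

lemma csym_superset:
  assumes "finite K" "Poly_Mapping.keys f \<subseteq> K"
  shows "csym f = (\<Sum>m\<in>K. sconst (Poly_Mapping.lookup f m) * csym_mono m)"
  unfolding csym_def
  by (rule sum.mono_neutral_left) (use assms in \<open>auto simp: in_keys_iff sconst_simps\<close>)

lemma csym_add: "csym (f + g) = csym f + csym g"
proof -
  let ?K = "Poly_Mapping.keys f \<union> Poly_Mapping.keys g"
  have "csym (f + g) = (\<Sum>m\<in>?K. sconst (Poly_Mapping.lookup (f + g) m) * csym_mono m)"
    by (rule csym_superset) (simp_all add: keys_add)
  moreover have "csym f = (\<Sum>m\<in>?K. sconst (Poly_Mapping.lookup f m) * csym_mono m)"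
    by (rule csym_superset) auto
  moreover have "csym g = (\<Sum>m\<in>?K. sconst (Poly_Mapping.lookup g m) * csym_mono m)"
    by (rule csym_superset) auto
  ultimately show ?thesis by (simp add: lookup_add sconst_simps distrib_right sum.distrib)
qed

lemma csym_0: "csym 0 = 0"
  by (simp add: csym_def)

lemma csym_diff: "csym (f - g) = csym f - csym g"
  using csym_add[of "f - g" g] by simp

lemma csym_sum: "csym (\<Sum>i\<in>I. f i) = (\<Sum>i\<in>I. csym (f i))"
  by (induction I rule: infinite_finite_induct) (auto simp: csym_0 csym_add)

lemma csym_single: "csym (Poly_Mapping.single m a) = sconst a * csym_mono m"
  by (simp add: csym_def sconst_simps)

lemma csym_mono_add: "csym_mono (m + m') = csym_mono m * csym_mono m'"
  by (simp add: csym_mono_def)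

lemma csym_mult: "csym (f * g) = csym f * csym g"
proof -
  have "csym (f * g) = csym ((\<Sum>m\<in>Poly_Mapping.keys f. Poly_Mapping.single m (Poly_Mapping.lookup f m)) *
      (\<Sum>m\<in>Poly_Mapping.keys g. Poly_Mapping.single m (Poly_Mapping.lookup g m)))"
    by (simp flip: poly_mapping_eq_sum_single)
  also have "\<dots> = (\<Sum>m\<in>Poly_Mapping.keys f. \<Sum>m'\<in>Poly_Mapping.keys g.
      sconst (Poly_Mapping.lookup f m * Poly_Mapping.lookup g m') * csym_mono (m + m'))"
    by (simp only: sum_product csym_sum mult_single csym_single)
  also have "\<dots> = csym f * csym g"
    by (simp add: csym_def sum_product csym_mono_add sconst_simps ac_simps)
  finally show ?thesis .
qed

lemma csym_gconst: "csym (gconst a) = sconst a"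
  and csym_gvar: "csym (gvar d j) = dpow d j"
  by (simp_all add: gconst_def gvar_def csym_single csym_mono_def sconst_simps)

lemma csym_1: "csym 1 = 1"
  using csym_gconst[of 1] by (simp add: gconst_def sconst_simps flip: single_one zero_multiset_def)

lemma csym_of_nat: "csym (of_nat n) = of_nat n"
  by (induction n) (simp_all add: csym_0 csym_add csym_1)

lemma csym_Gamma_rels: "g \<in> Gamma_rels N \<Longrightarrow> csym g = 0"
  by (auto simp: Gamma_rels_def csym_diff csym_gvar csym_1 csym_mult csym_of_nat csym_gconst csym_sum
      dpow_mult dpow_scale dpow_add)

lemma csym_Gamma_ideal:
  assumes "f \<in> Gamma_ideal N" shows "csym f = 0"
proof -
  obtain ps where "f = (\<Sum>(r, g)\<leftarrow>ps. r * g)" "\<forall>(r, g)\<in>set ps. g \<in> Gamma_rels N"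
    using assms by (auto simp: Gamma_ideal_def)
  then show ?thesis
    by (induction ps arbitrary: f) (auto simp: csym_0 csym_add csym_mult csym_Gamma_rels)
qed

lemma shom_csym_mono: "shom (gdeg m) (csym_mono m)"
proof (induction m)
  case (add v m)
  then show ?case using shom_mult[OF shom_dpow[of "snd v" "fst v"]]
    by (simp add: gdeg_def csym_mono_def split_beta)
qed (simp add: gdeg_def csym_mono_def shom_1)

lemma shom_csym:
  assumes "ghomog n f" shows "shom n (csym f)"
  unfolding csym_def
proof (intro shom_sum shom_sconst_mult)
  fix m assume "m \<in> Poly_Mapping.keys f"
  then show "shom n (csym_mono m)" using assms shom_csym_mono[of m] by (simp add: ghomog_def)
qed

subsection \<open>Symbols of composites\<close>

definition symb :: "nat \<Rightarrow> ('a::comm_ring_1 \<Rightarrow> 'a) \<Rightarrow> 'a shuf" where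
  "symb n P = Shuf (thetaN n P)"

lemma shuf_nth_symb: "shuf_nth (symb n P) xs = thetaN n P xs"
  by (simp add: symb_def)

lemma shift_symb: "shift x (symb (Suc n) P) = symb n (comm P x)"
  by (rule shuf_eqI) (simp add: shuf_nth_symb thetaN_Suc)

lemma symb_zero: "symb n (\<lambda>x. 0) = 0"
  and symb_plus: "symb n (\<lambda>x. P x + Q x) = symb n P + symb n Q"
  by (auto intro!: shuf_eqI simp: shuf_nth_symb thetaN_zero thetaN_plus)

lemma symb_0: "symb 0 P = sconst (P 1)"
proof (rule shuf_eqI)
  show "shuf_nth (symb 0 P) xs = shuf_nth (sconst (P 1)) xs" for xs
    by (cases xs) (simp_all add: shuf_nth_symb shuf_nth_sconst thetaN_0 thetaN_length)
qed

text \<open>Commutators obey the Leibniz rule for composition and \<open>shift x\<close> obeys it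
  for the shuffle product; induction on the total order compares the two.\<close>

lemma symb_comp:
  "diffop phi i P \<Longrightarrow> diffop phi j Q \<Longrightarrow> symb (i + j) (P \<circ> Q) = symb i P * symb j Q"
proof (induction "i + j" arbitrary: i j P Q)
  case 0
  then obtain a b where "P = (\<lambda>x. a * x)" "Q = (\<lambda>x. b * x)" by auto
  then show ?case using 0 by (simp add: symb_0 sconst_simps)
next
  case (Suc n)
  have kP: "klin phi P" and kQ: "klin phi Q" using Suc.prems diffop_klin by blast+
  have 1: "symb n (comm P x \<circ> Q) = shift x (symb i P) * symb j Q" for x
  proof (cases i)
    case 0
    then have "comm P x = (\<lambda>x. 0)" using Suc.prems comm_mult_left by auto
    then show ?thesis by (simp add: 0 symb_0 comp_def symb_zero)
  next
    case (Suc i')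
    then show ?thesis using Suc.hyps(1)[of i' j "comm P x" Q] Suc.hyps(2) Suc.prems
      by (simp add: diffop_Suc_comm shift_symb)
  qed
  have 2: "symb n (P \<circ> comm Q x) = symb i P * shift x (symb j Q)" for x
  proof (cases j)
    case 0
    then have "comm Q x = (\<lambda>x. 0)" using Suc.prems comm_mult_left by auto
    then show ?thesis by (simp add: 0 symb_0 comp_def symb_zero klin_zero[OF kP])
  next
    case (Suc j')
    then show ?thesis using Suc.hyps(1)[of i j' P "comm Q x"] Suc.hyps(2) Suc.prems
      by (simp add: diffop_Suc_comm shift_symb)
  qed
  have "shift x (symb (Suc n) (P \<circ> Q)) = shift x (symb i P * symb j Q)" for x
    using 1[of x] 2[of x] by (simp only: shift_symb comm_comp[OF kP] symb_plus shift_mult)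
  moreover have "shuf_nth (symb i P) [] * shuf_nth (symb j Q) [] = 0"
    using Suc.hyps(2) by (cases i; cases j) (simp_all add: shuf_nth_symb thetaN_length)
  ultimately have "symb (Suc n) (P \<circ> Q) = symb i P * symb j Q"
    unfolding shuf_eq_iff[of "symb (Suc n) (P \<circ> Q)"] by (simp add: shuf_nth_symb thetaN_length)
  then show ?case using Suc.hyps(2) by simp
qed

lemma symb_HS: "D \<in> HS phi \<Longrightarrow> symb n (D n) = dpow (D 1) n"
  by (rule shuf_eqI) (simp add: shuf_nth_symb thetaN_HS dpow_def)

lemma symb_list_op:
  assumes "fst ` set xs \<subseteq> Ider phi"
  shows "diffop phi (\<Sum>v\<leftarrow>xs. snd v) (list_op phi xs) \<and>
    symb (\<Sum>v\<leftarrow>xs. snd v) (list_op phi xs) = csym_mono (mset xs)"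
  using assms
proof (induction xs)
  case Nil
  have "diffop phi 0 id" by (simp, rule exI[of _ 1], simp add: fun_eq_iff)
  then show ?case by (simp add: list_op_Nil symb_0 csym_mono_def sconst_simps id_def del: diffop.simps)
next
  case (Cons v xs)
  obtain d j where v: "v = (d, j)" by fastforce
  have D: "hsop phi d \<in> HS phi" "hsop phi d 1 = d"
    using Cons.prems hsop_HS[of d phi] by (auto simp: v)
  have "diffop phi (j + (\<Sum>v\<leftarrow>xs. snd v)) (hsop phi d j \<circ> list_op phi xs)"
    by (rule diffop_comp) (use Cons diffop_HS[OF D(1)] in auto)
  moreover have "symb (j + (\<Sum>v\<leftarrow>xs. snd v)) (hsop phi d j \<circ> list_op phi xs) =
      symb j (hsop phi d j) * symb (\<Sum>v\<leftarrow>xs. snd v) (list_op phi xs)"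
    by (rule symb_comp) (use Cons diffop_HS[OF D(1)] in auto)
  ultimately show ?case
    using Cons symb_HS[OF D(1)] D(2) by (simp add: v list_op_Cons csym_mono_def comp_def)
qed

text \<open>\<open>theta\<close> after \<open>vartheta\<close> is \<open>csym\<close>:
  \<open>symb_comp\<close> hides the ordering chosen in \<open>mono_op\<close>, and
  \<open>thetaN_HS\<close> hides the choice made by \<open>hsop\<close>. Questions about
  \<open>vartheta\<close> thereby become questions about \<open>csym\<close>.\<close>

lemma symb_varthetaP:
  assumes f: "gpoly_over (Ider phi) f" "ghomog n f"
  shows "diffop phi n (varthetaP phi f)" "symb n (varthetaP phi f) = csym f"
proof -
  have m: "diffop phi n (mono_op phi m) \<and> symb n (mono_op phi m) = csym_mono m"
    if m: "m \<in> Poly_Mapping.keys f" for m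
  proof -
    obtain xs where xs: "mset xs = m" "mono_op phi m = list_op phi xs"
      using mono_op_eq_list_op by blast
    have "(\<Sum>v\<leftarrow>xs. snd v) = n" using f(2) m by (auto simp: ghomog_def gdeg_mset simp flip: xs(1))
    then show ?thesis using gpoly_over_keys[OF f(1) m] symb_list_op[of xs phi] xs by auto
  qed
  show "diffop phi n (varthetaP phi f)"
    unfolding varthetaP_def by (intro diffop_sum diffop_times) (use m in blast)
  show "symb n (varthetaP phi f) = csym f"
    unfolding varthetaP_def csym_def
  proof (rule shuf_eqI)
    fix xs
    have "thetaN n (mono_op phi m) xs = shuf_nth (csym_mono m) xs" if "m \<in> Poly_Mapping.keys f" for m
      using m[OF that] by (metis shuf_nth_symb)
    then show "shuf_nth (symb n (\<lambda>x. \<Sum>m\<in>Poly_Mapping.keys f. Poly_Mapping.lookup f m * mono_op phi m x)) xs =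
        shuf_nth (\<Sum>m\<in>Poly_Mapping.keys f. sconst (Poly_Mapping.lookup f m) * csym_mono m) xs"
      by (simp add: shuf_nth_symb thetaN_sum thetaN_times shuf_nth_sum)
  qed
qed

section \<open>Congruence modulo the ideal of relations\<close>

lemma gpoly_over_add: "gpoly_over N f \<Longrightarrow> gpoly_over N g \<Longrightarrow> gpoly_over N (f + g)"
  using keys_add[of f g] unfolding gpoly_over_def by blast

lemma gpoly_over_mult:
  assumes "gpoly_over N f" "gpoly_over N g" shows "gpoly_over N (f * g)"
  unfolding gpoly_over_def
proof
  fix m assume "m \<in> Poly_Mapping.keys (f * g)"
  then obtain a b where "m = a + b" "a \<in> Poly_Mapping.keys f" "b \<in> Poly_Mapping.keys g"
    using keys_mult[of f g] by blast
  then show "\<forall>v\<in>#m. fst v \<in> N" using assms by (auto simp: gpoly_over_def)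
qed

lemma gpoly_over_0: "gpoly_over N 0"
  and gpoly_over_gconst: "gpoly_over N (gconst a)"
  and gpoly_over_gvar: "d \<in> N \<Longrightarrow> gpoly_over N (gvar d j)"
  by (auto simp: gpoly_over_def gconst_def gvar_def)

lemma gpoly_over_sum: "(\<And>i. i \<in> I \<Longrightarrow> gpoly_over N (f i)) \<Longrightarrow> gpoly_over N (\<Sum>i\<in>I. f i)"
  by (induction I rule: infinite_finite_induct) (auto intro: gpoly_over_add gpoly_over_0)

lemma ghomog_add: "ghomog n f \<Longrightarrow> ghomog n g \<Longrightarrow> ghomog n (f + g)"
  using keys_add[of f g] unfolding ghomog_def by blast

lemma ghomog_mult:
  assumes "ghomog i f" "ghomog j g" shows "ghomog (i + j) (f * g)"
  unfolding ghomog_def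
proof
  fix m assume "m \<in> Poly_Mapping.keys (f * g)"
  then obtain a b where "m = a + b" "a \<in> Poly_Mapping.keys f" "b \<in> Poly_Mapping.keys g"
    using keys_mult[of f g] by blast
  then show "gdeg m = i + j" using assms by (auto simp: ghomog_def gdeg_def)
qed

lemma ghomog_0: "ghomog n 0"
  and ghomog_gconst: "ghomog 0 (gconst a)"
  and ghomog_gvar: "ghomog j (gvar d j)"
  by (auto simp: ghomog_def gconst_def gvar_def gdeg_def)

lemma ghomog_sum: "(\<And>i. i \<in> I \<Longrightarrow> ghomog n (f i)) \<Longrightarrow> ghomog n (\<Sum>i\<in>I. f i)"
  by (induction I rule: infinite_finite_induct) (auto intro: ghomog_add ghomog_0)

lemma Gamma_ideal_0: "0 \<in> Gamma_ideal N"
  unfolding Gamma_ideal_def by (rule CollectI, rule exI[of _ "[]"]) simp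

lemma Gamma_ideal_add:
  assumes "f \<in> Gamma_ideal N" "g \<in> Gamma_ideal N" shows "f + g \<in> Gamma_ideal N"
proof -
  obtain ps qs where "f = (\<Sum>(r, g)\<leftarrow>ps. r * g)" "\<forall>(r, g)\<in>set ps. gpoly_over N r \<and> g \<in> Gamma_rels N"
    "g = (\<Sum>(r, g)\<leftarrow>qs. r * g)" "\<forall>(r, g)\<in>set qs. gpoly_over N r \<and> g \<in> Gamma_rels N"
    using assms unfolding Gamma_ideal_def by blast
  then have "f + g = (\<Sum>(r, g)\<leftarrow>ps @ qs. r * g)"
    "\<forall>(r, g)\<in>set (ps @ qs). gpoly_over N r \<and> g \<in> Gamma_rels N" by auto
  then show ?thesis unfolding Gamma_ideal_def by blast
qed

lemma Gamma_ideal_mult: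
  assumes "gpoly_over N h" "f \<in> Gamma_ideal N" shows "h * f \<in> Gamma_ideal N"
proof -
  obtain ps where ps: "f = (\<Sum>(r, g)\<leftarrow>ps. r * g)"
    "\<forall>(r, g)\<in>set ps. gpoly_over N r \<and> g \<in> Gamma_rels N"
    using assms(2) unfolding Gamma_ideal_def by blast
  have "h * (\<Sum>(r, g)\<leftarrow>ps. r * g) = (\<Sum>(r, g)\<leftarrow>map (\<lambda>(r, g). (h * r, g)) ps. r * g)" for ps
    by (induction ps) (auto simp: algebra_simps)
  then have "h * f = (\<Sum>(r, g)\<leftarrow>map (\<lambda>(r, g). (h * r, g)) ps. r * g)" using ps(1) by simp
  moreover have "\<forall>(r, g)\<in>set (map (\<lambda>(r, g). (h * r, g)) ps). gpoly_over N r \<and> g \<in> Gamma_rels N"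
    using ps(2) assms(1) by (auto intro: gpoly_over_mult)
  ultimately show ?thesis unfolding Gamma_ideal_def by blast
qed

lemma Gamma_ideal_rel: "g \<in> Gamma_rels N \<Longrightarrow> g \<in> Gamma_ideal N"
  unfolding Gamma_ideal_def
  by (rule CollectI, rule exI[of _ "[(1, g)]"]) (simp add: gpoly_over_def)

lemma Gamma_ideal_minus: "f \<in> Gamma_ideal N \<Longrightarrow> - f \<in> Gamma_ideal N"
  using Gamma_ideal_mult[of N "- 1" f] by (simp add: gpoly_over_def)

text \<open>\<open>Gamma_ideal N\<close> absorbs multipliers with symbols from \<open>N\<close>,
  hence the \<open>gpoly_over\<close> conditions wherever congruences are multiplied.\<close>

definition gcong :: "('a::comm_ring_1 \<Rightarrow> 'a) set \<Rightarrow> 'a gpoly \<Rightarrow> 'a gpoly \<Rightarrow> bool" where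
  "gcong N f g \<longleftrightarrow> f - g \<in> Gamma_ideal N"

lemma gcong_refl: "gcong N f f"
  by (simp add: gcong_def Gamma_ideal_0)

lemma gcong_sym: "gcong N f g \<Longrightarrow> gcong N g f"
  using Gamma_ideal_minus[of "f - g"] by (simp add: gcong_def)

lemma gcong_trans [trans]: "gcong N f g \<Longrightarrow> gcong N g h \<Longrightarrow> gcong N f h"
  using Gamma_ideal_add[of "f - g" N "g - h"] by (simp add: gcong_def)

lemma gcong_eq_trans [trans]: "gcong N f g \<Longrightarrow> g = h \<Longrightarrow> gcong N f h"
  and eq_gcong_trans [trans]: "f = g \<Longrightarrow> gcong N g h \<Longrightarrow> gcong N f h"
  by simp_all

lemma gcong_add: "gcong N f f' \<Longrightarrow> gcong N g g' \<Longrightarrow> gcong N (f + g) (f' + g')"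
  using Gamma_ideal_add[of "f - f'" N "g - g'"] by (simp add: gcong_def algebra_simps)

lemma gcong_sum: "(\<And>i. i \<in> I \<Longrightarrow> gcong N (f i) (g i)) \<Longrightarrow> gcong N (\<Sum>i\<in>I. f i) (\<Sum>i\<in>I. g i)"
  by (induction I rule: infinite_finite_induct) (auto intro: gcong_add gcong_refl)

lemma gcong_mult_left: "gpoly_over N h \<Longrightarrow> gcong N f g \<Longrightarrow> gcong N (h * f) (h * g)"
  using Gamma_ideal_mult[of N h "f - g"] by (simp add: gcong_def algebra_simps)

lemma gcong_mult:
  assumes "gcong N f f'" "gcong N g g'" "gpoly_over N f" "gpoly_over N g'"
  shows "gcong N (f * g) (f' * g')"
proof -
  have "gcong N (f * g) (f * g')" by (rule gcong_mult_left) fact+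
  also have "gcong N (f * g') (f' * g')"
    using gcong_mult_left[of N g' f f'] assms by (simp add: mult.commute)
  finally show ?thesis .
qed

lemma gcong_rels:
  assumes "x \<in> N"
  shows "gcong N (gvar x 0) 1"
    and "gcong N (gvar x i * gvar x j) (of_nat ((i + j) choose i) * gvar x (i + j))"
    and "gcong N (gvar (\<lambda>t. a * x t) j) (gconst (a ^ j) * gvar x j)"
    and "y \<in> N \<Longrightarrow> gcong N (gvar (\<lambda>t. x t + y t) n) (\<Sum>i\<le>n. gvar x i * gvar y (n - i))"
  unfolding gcong_def by (rule Gamma_ideal_rel, unfold Gamma_rels_def, use assms in blast)+

section \<open>Contraction with a dual basis of the module of derivations\<close>

text \<open>A dual basis in the sense of projective modules: the \<open>b i\<close> generate but may
  be dependent, and \<open>c i (b j)\<close> need not be a Kronecker delta. The \<open>c i\<close>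
  are constrained on derivations only, so each use must exhibit its argument as one.\<close>

locale der_basis =
  fixes phi :: "'k::comm_ring_1 \<Rightarrow> 'a::comm_ring_1"
    and r :: nat and b :: "nat \<Rightarrow> 'a \<Rightarrow> 'a" and c :: "nat \<Rightarrow> ('a \<Rightarrow> 'a) \<Rightarrow> 'a"
  assumes b_Der: "b i \<in> Der phi"
    and c_add: "d \<in> Der phi \<Longrightarrow> e \<in> Der phi \<Longrightarrow> c i (\<lambda>x. d x + e x) = c i d + c i e"
    and c_scale: "d \<in> Der phi \<Longrightarrow> c i (\<lambda>x. a * d x) = a * c i d"
    and expand: "d \<in> Der phi \<Longrightarrow> d x = (\<Sum>i<r. c i d * b i x)"

lemma fin_proj_module_imp_der_basis:
  fixes phi :: "'k::comm_ring_1 \<Rightarrow> 'a::comm_ring_1"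
  assumes "fin_proj_module (Der phi)"
  shows "\<exists>r b c. der_basis phi r b c"
proof -
  obtain n :: nat and e :: "('a \<Rightarrow> 'a) \<Rightarrow> nat \<Rightarrow> 'a" and p :: "(nat \<Rightarrow> 'a) \<Rightarrow> 'a \<Rightarrow> 'a" where
    H: "(\<forall>m\<in>Der phi. \<forall>i\<ge>n. e m i = 0) \<and>
      (\<forall>m\<in>Der phi. \<forall>m'\<in>Der phi. e (\<lambda>x. m x + m' x) = (\<lambda>i. e m i + e m' i)) \<and>
      (\<forall>m\<in>Der phi. \<forall>a. e (\<lambda>x. a * m x) = (\<lambda>i. a * e m i)) \<and>
      (\<forall>v. p v \<in> Der phi) \<and>
      (\<forall>v w. p (\<lambda>i. v i + w i) = (\<lambda>x. p v x + p w x)) \<and>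
      (\<forall>v a. p (\<lambda>i. a * v i) = (\<lambda>x. a * p v x)) \<and>
      (\<forall>m\<in>Der phi. p (e m) = m)"
    using assms unfolding fin_proj_module_def by (elim exE) (rule that)
  have e0: "e m i = 0" if "m \<in> Der phi" "n \<le> i" for m i using H that by blast
  have e_add: "e (\<lambda>x. m x + m' x) = (\<lambda>i. e m i + e m' i)" if "m \<in> Der phi" "m' \<in> Der phi" for m m'
    using H that by blast
  have e_scale: "e (\<lambda>x. a * m x) = (\<lambda>i. a * e m i)" if "m \<in> Der phi" for m a using H that by blast
  have p_Der: "p v \<in> Der phi" for v using H by blast
  have p_add: "p (\<lambda>i. v i + w i) = (\<lambda>x. p v x + p w x)" for v w using H by blast
  have p_scale: "p (\<lambda>i. a * v i) = (\<lambda>x. a * p v x)" for v a using H by blast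
  have pe: "p (e m) = m" if "m \<in> Der phi" for m using H that by blast
  \<comment> \<open>The images of the unit vectors. The value of \<open>p\<close> is then computed
    by adding one coordinate at a time, and \<open>e0\<close> shows that \<open>e d\<close> equals
    its own truncation at \<open>n\<close>.\<close>
  let ?b = "\<lambda>i. p (\<lambda>j. if j = i then 1 else 0)"
  have p0: "p (\<lambda>i. 0) = (\<lambda>x. 0)" using p_scale[of 0 "\<lambda>i. 0"] by simp
  have p_sum: "p (\<lambda>j. if j < k then v j else 0) x = (\<Sum>i<k. v i * ?b i x)" for v k x
  proof (induction k)
    case (Suc k)
    have "(\<lambda>j. if j < Suc k then v j else 0) =
        (\<lambda>j. (if j < k then v j else 0) + v k * (if j = k then 1 else 0))"
      by (auto simp: fun_eq_iff less_Suc_eq)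
    then have "p (\<lambda>j. if j < Suc k then v j else 0) x = p (\<lambda>j. if j < k then v j else 0) x + v k * ?b k x"
      by (simp only: p_add p_scale)
    then show ?case using Suc by simp
  qed (simp add: p0)
  have "der_basis phi n ?b (\<lambda>i d. e d i)"
  proof
    fix d x assume d: "d \<in> Der phi"
    then have "(\<lambda>j. if j < n then e d j else 0) = e d" using e0 by (auto simp: fun_eq_iff)
    then show "d x = (\<Sum>i<n. e d i * ?b i x)" using p_sum[of n "e d" x] pe[OF d] by simp
  qed (simp_all add: p_Der e_add e_scale)
  then show ?thesis by blast
qed

context der_basis
begin

lemma c_zero: "c i (\<lambda>x. 0) = 0"
  using c_scale[OF Der_zero, of i 0] by simp

lemma c_sum: "(\<And>j. j \<in> I \<Longrightarrow> d j \<in> Der phi) \<Longrightarrow> c i (\<lambda>x. \<Sum>j\<in>I. d j x) = (\<Sum>j\<in>I. c i (d j))"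
  by (induction I rule: infinite_finite_induct) (auto simp: c_zero c_add Der_sum)

text \<open>The Leibniz rule in \<open>y\<close> writes \<open>U\<close> at a product as a
  combination of derivations in \<open>x\<close> with coefficients free of \<open>x\<close>, and
  \<open>c i\<close> is linear over these.\<close>

lemma c_Der:
  assumes "\<And>y. (\<lambda>x. U x y) \<in> Der phi" and U: "\<And>x. U x \<in> Der phi"
  shows "(\<lambda>y. c i (\<lambda>x. U x y)) \<in> Der phi"
proof -
  note k = Der_klin[OF U]
  have "(\<lambda>x. U x (phi a * y)) = (\<lambda>x. phi a * U x y)" for a y
    by (simp add: klin_scale[OF k])
  then have "c i (\<lambda>x. U x (phi a * y)) = phi a * c i (\<lambda>x. U x y)" for a y
    using c_scale[OF assms(1)] by simp
  moreover have "c i (\<lambda>x. U x (y * z)) = y * c i (\<lambda>x. U x z) + z * c i (\<lambda>x. U x y)" for y z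
    by (simp add: Der_mult[OF U] c_add c_scale Der_times assms(1))
  moreover have "c i (\<lambda>x. U x (y + z)) = c i (\<lambda>x. U x y) + c i (\<lambda>x. U x z)" for y z
    by (simp add: klin_add[OF k] c_add assms(1))
  ultimately show ?thesis by (simp add: Der_def klin_def)
qed

text \<open>Expand the slot \<open>y\<close> in the \<open>b j\<close>, with coordinates
  \<open>w j\<close>: both orders of contraction give
  \<open>\<Sum>j<r. c k (w j) * c i (b j)\<close>.\<close>

lemma c_commute:
  assumes U1: "\<And>y. (\<lambda>x. U x y) \<in> Der phi" and U2: "\<And>x. U x \<in> Der phi"
  shows "c i (\<lambda>y. c k (\<lambda>x. U x y)) = c k (\<lambda>x. c i (U x))"
proof -
  define w where "w = (\<lambda>j x. c j (U x))"
  have w: "w j \<in> Der phi" for j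
    unfolding w_def using c_Der[of "\<lambda>y x. U x y"] U1 U2 by simp
  have U: "U x y = (\<Sum>j<r. w j x * b j y)" for x y
    using expand[OF U2] by (simp add: w_def)
  have wb: "(\<lambda>x. w j x * b j y) \<in> Der phi" for j y
    using Der_times[OF w, of "b j y" j] by (simp add: mult.commute)
  have "c k (\<lambda>x. w j x * b j y) = c k (w j) * b j y" for j y
    using c_scale[OF w, of k "b j y" j] by (simp add: mult.commute)
  then have "c i (\<lambda>y. c k (\<lambda>x. U x y)) = c i (\<lambda>y. \<Sum>j<r. c k (w j) * b j y)"
    by (simp add: U c_sum wb)
  also have "\<dots> = (\<Sum>j<r. c k (w j) * c i (b j))"
    by (simp add: c_sum Der_times b_Der c_scale)
  also have "\<dots> = (\<Sum>j<r. c k (\<lambda>x. c i (b j) * w j x))"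
    by (simp add: c_scale w) (simp add: mult.commute)
  also have "\<dots> = c k (\<lambda>x. \<Sum>j<r. c i (b j) * w j x)"
    by (simp add: c_sum Der_times w)
  also have "\<dots> = c k (\<lambda>x. c i (U x))"
  proof -
    have "c i (U x) = (\<Sum>j<r. c i (b j) * w j x)" for x
    proof -
      have "c i (U x) = c i (\<lambda>y. \<Sum>j<r. w j x * b j y)" by (simp add: U[symmetric])
      then show ?thesis by (simp add: c_sum Der_times b_Der c_scale) (simp add: mult.commute)
    qed
    then show ?thesis by simp
  qed
  finally show ?thesis .
qed

section \<open>Multiderivations and contraction of the first slot\<close>

definition mder :: "'a shuf \<Rightarrow> bool" where
  "mder u \<longleftrightarrow> (\<forall>ys zs. (\<lambda>x. shuf_nth u (ys @ x # zs)) \<in> Der phi)"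

lemma mderD: "mder u \<Longrightarrow> (\<lambda>x. shuf_nth u (ys @ x # zs)) \<in> Der phi"
  by (simp add: mder_def)

lemma mder_first: "mder u \<Longrightarrow> (\<lambda>x. shuf_nth u (x # zs)) \<in> Der phi"
  using mderD[of u "[]"] by simp

lemma mder_shift: "mder u \<Longrightarrow> mder (shift x u)"
  using mderD[of u "x # _"] by (simp add: mder_def)

lemma mder_0: "mder 0"
  and mder_add: "mder u \<Longrightarrow> mder v \<Longrightarrow> mder (u + v)"
  and mder_sconst_mult: "mder u \<Longrightarrow> mder (sconst a * u)"
  and mder_1: "mder 1"
  by (simp_all add: mder_def Der_zero Der_plus Der_times)

lemma mder_sum: "(\<And>i. i \<in> I \<Longrightarrow> mder (u i)) \<Longrightarrow> mder (\<Sum>i\<in>I. u i)"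
  by (induction I rule: infinite_finite_induct) (auto simp: mder_0 mder_add)

text \<open>The distinguished letter \<open>x\<close> is a parameter of \<open>U\<close>, outside
  the word, so the induction can distribute the letters of \<open>zs\<close> over both factors
  without losing track of it.\<close>

lemma Der_shuf_mult:
  assumes "\<And>zs. (\<lambda>x. shuf_nth (U x) zs) \<in> Der phi"
  shows "(\<lambda>x. shuf_nth (U x * v) zs) \<in> Der phi"
  using assms
proof (induction zs arbitrary: U v)
  case Nil
  then show ?case using Der_times[OF Nil[of "[]"], of "shuf_nth v []"] by (simp add: mult.commute)
next
  case (Cons z zs)
  have "(\<lambda>x. shuf_nth (shift z (U x) * v) zs) \<in> Der phi"
    by (rule Cons.IH) (simp add: Cons.prems)
  moreover have "(\<lambda>x. shuf_nth (U x * shift z v) zs) \<in> Der phi"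
    by (rule Cons.IH) (rule Cons.prems)
  ultimately show ?case by (simp add: shuf_nth_mult_Cons Der_plus)
qed

lemma mder_mult:
  assumes "mder u" "mder v" shows "mder (u * v)"
proof -
  have "(\<lambda>x. shuf_nth (u * v) (ys @ x # zs)) \<in> Der phi" for ys zs
    using assms
  proof (induction ys arbitrary: u v)
    case Nil
    have "(\<lambda>x. shuf_nth (shift x u * v) zs) \<in> Der phi"
      by (rule Der_shuf_mult) (simp add: mder_first Nil)
    moreover have "(\<lambda>x. shuf_nth (shift x v * u) zs) \<in> Der phi"
      by (rule Der_shuf_mult) (simp add: mder_first Nil)
    ultimately show ?case by (simp add: shuf_nth_mult_Cons Der_plus mult.commute)
  next
    case (Cons y ys)
    then show ?case by (simp add: shuf_nth_mult_Cons Der_plus mder_shift)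
  qed
  then show ?thesis by (simp add: mder_def)
qed

lemma mder_dpow:
  assumes "d \<in> Der phi" shows "mder (dpow d j)"
  unfolding mder_def
proof (intro allI)
  fix ys zs
  let ?a = "if length ys + Suc (length zs) = j then (\<Prod>x\<leftarrow>ys. d x) * (\<Prod>x\<leftarrow>zs. d x) else 0"
  have "(\<lambda>x. shuf_nth (dpow d j) (ys @ x # zs)) = (\<lambda>x. ?a * d x)"
    by (auto simp: dpow_def fun_eq_iff algebra_simps)
  then show "(\<lambda>x. shuf_nth (dpow d j) (ys @ x # zs)) \<in> Der phi"
    using Der_times[OF assms] by simp
qed

lemma mder_csym_mono: "fst ` set_mset m \<subseteq> Der phi \<Longrightarrow> mder (csym_mono m)"
  by (induction m) (auto simp: csym_mono_def mder_1 mder_mult mder_dpow)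

text \<open>Interior product with the linear form \<open>c i\<close> on derivations;
  \<open>shift x\<close> is the analogue for the form \<open>d \<mapsto> d x\<close>.\<close>

definition contr :: "nat \<Rightarrow> 'a shuf \<Rightarrow> 'a shuf" where
  "contr i u = Shuf (\<lambda>xs. c i (\<lambda>x. shuf_nth u (x # xs)))"

lemma shuf_nth_contr [simp]: "shuf_nth (contr i u) xs = c i (\<lambda>x. shuf_nth u (x # xs))"
  by (simp add: contr_def)

lemma mder_contr:
  assumes "mder u" shows "mder (contr i u)"
  unfolding mder_def
proof (intro allI)
  fix ys zs
  show "(\<lambda>y. shuf_nth (contr i u) (ys @ y # zs)) \<in> Der phi"
    unfolding shuf_nth_contr
    by (rule c_Der) (use mder_first[OF assms] mderD[OF assms, of "_ # ys"] in auto)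
qed

lemma mder_contr_pow: "mder u \<Longrightarrow> mder ((contr i ^^ a) u)"
  by (induction a) (simp_all add: mder_contr)

lemma contr_0: "contr i 0 = 0"
  by (rule shuf_eqI) (simp add: c_zero)

lemma contr_add: "mder u \<Longrightarrow> mder v \<Longrightarrow> contr i (u + v) = contr i u + contr i v"
  by (rule shuf_eqI) (simp add: c_add mder_first)

lemma contr_sconst_mult: "mder u \<Longrightarrow> contr i (sconst a * u) = sconst a * contr i u"
  by (rule shuf_eqI) (simp add: c_scale mder_first)

lemma contr_sum: "(\<And>j. j \<in> I \<Longrightarrow> mder (u j)) \<Longrightarrow> contr i (\<Sum>j\<in>I. u j) = (\<Sum>j\<in>I. contr i (u j))"
  by (induction I rule: infinite_finite_induct) (auto simp: contr_0 contr_add mder_sum)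

lemma c_shuf_mult:
  assumes "\<And>zs. (\<lambda>x. shuf_nth (U x) zs) \<in> Der phi"
  shows "c i (\<lambda>x. shuf_nth (U x * v) zs) = shuf_nth (Shuf (\<lambda>zs. c i (\<lambda>x. shuf_nth (U x) zs)) * v) zs"
  using assms
proof (induction zs arbitrary: U v)
  case Nil
  then show ?case using c_scale[OF Nil[of "[]"], of i "shuf_nth v []"] by (simp add: mult.commute)
next
  case (Cons z zs)
  have *: "\<And>zs. (\<lambda>x. shuf_nth (shift z (U x)) zs) \<in> Der phi" by (simp add: Cons.prems)
  have "shift z (Shuf (\<lambda>zs. c i (\<lambda>x. shuf_nth (U x) zs))) =
      Shuf (\<lambda>zs. c i (\<lambda>x. shuf_nth (shift z (U x)) zs))"
    by (rule shuf_eqI) simp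
  then show ?case
    using Cons.IH[OF *, of v] Cons.IH[OF Cons.prems, of "shift z v"]
    by (simp add: shuf_nth_mult_Cons c_add Der_shuf_mult[OF *] Der_shuf_mult[OF Cons.prems])
qed

text \<open>The first letter of a shuffle product lands in \<open>u\<close> or in \<open>v\<close>,
  and the linear form \<open>c i\<close> passes through the factor that it does not meet.\<close>

lemma contr_mult:
  assumes "mder u" "mder v" shows "contr i (u * v) = contr i u * v + u * contr i v"
proof (rule shuf_eqI)
  fix xs
  have S: "(\<lambda>x. shuf_nth (shift x w) zs) \<in> Der phi" if "mder w" for w zs
    using mder_first[OF that] by simp
  have "shuf_nth (contr i (u * v)) xs =
      c i (\<lambda>x. shuf_nth (shift x u * v) xs + shuf_nth (shift x v * u) xs)"
    by (simp add: shuf_nth_mult_Cons mult.commute)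
  also have "\<dots> = c i (\<lambda>x. shuf_nth (shift x u * v) xs) + c i (\<lambda>x. shuf_nth (shift x v * u) xs)"
    by (intro c_add Der_shuf_mult S assms)
  also have "\<dots> = shuf_nth (contr i u * v) xs + shuf_nth (contr i v * u) xs"
    by (simp only: c_shuf_mult[OF S[OF assms(1)]] c_shuf_mult[OF S[OF assms(2)]] contr_def shuf_nth_shift)
  finally show "shuf_nth (contr i (u * v)) xs = shuf_nth (contr i u * v + u * contr i v) xs"
    by (simp add: mult.commute)
qed

lemma contr_pow_0: "(contr i ^^ a) 0 = 0"
  by (induction a) (simp_all add: contr_0)

lemma contr_pow_add: "mder u \<Longrightarrow> mder v \<Longrightarrow> (contr i ^^ a) (u + v) = (contr i ^^ a) u + (contr i ^^ a) v"
  by (induction a) (simp_all add: contr_add mder_contr_pow)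

lemma contr_pow_sconst_mult: "mder u \<Longrightarrow> (contr i ^^ a) (sconst e * u) = sconst e * (contr i ^^ a) u"
  by (induction a) (simp_all add: contr_sconst_mult mder_contr_pow)

lemma contr_pow_mult:
  assumes u: "mder u" and v: "mder v"
  shows "(contr i ^^ a) (u * v) =
    (\<Sum>s\<le>a. sconst (of_nat (a choose s)) * ((contr i ^^ s) u * (contr i ^^ (a - s)) v))"
proof (induction a)
  case (Suc a)
  define F where "F = (\<lambda>s t. (contr i ^^ s) u * (contr i ^^ t) v)"
  define B where "B = (\<lambda>a s. sconst (of_nat (a choose s) :: 'a))"
  have B: "B (Suc a) (Suc s) = B a s + B a (Suc s)" "B a 0 = 1" for a s
    by (simp_all add: B_def sconst_simps)
  have B0: "B a s = 0" if "a < s" for s using that by (simp add: B_def binomial_eq_0 sconst_simps)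
  have F: "contr i (F s t) = F (Suc s) t + F s (Suc t)" for s t
    by (simp add: F_def contr_mult mder_contr_pow u v)
  have mF: "mder (F s t)" for s t
    by (simp add: F_def mder_mult mder_contr_pow u v)
  have "(contr i ^^ Suc a) (u * v) = contr i (\<Sum>s\<le>a. B a s * F s (a - s))"
    using Suc by (simp add: F_def B_def)
  also have "\<dots> = (\<Sum>s\<le>a. B a s * F (Suc s) (a - s)) + (\<Sum>s\<le>a. B a s * F s (Suc a - s))"
    by (simp add: contr_sum B_def contr_sconst_mult mder_sconst_mult mF F distrib_left sum.distrib Suc_diff_le)
  also have "(\<Sum>s\<le>a. B a s * F s (Suc a - s)) = (\<Sum>s\<le>Suc a. B a s * F s (Suc a - s))"
    by (simp add: B0)
  also have "\<dots> = F 0 (Suc a) + (\<Sum>s\<le>a. B a (Suc s) * F (Suc s) (a - s))"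
    by (subst sum.atMost_Suc_shift) (simp add: B)
  also have "(\<Sum>s\<le>a. B a s * F (Suc s) (a - s)) + (F 0 (Suc a) + (\<Sum>s\<le>a. B a (Suc s) * F (Suc s) (a - s))) =
      F 0 (Suc a) + (\<Sum>s\<le>a. B (Suc a) (Suc s) * F (Suc s) (a - s))"
    by (simp add: B distrib_right sum.distrib)
  also have "\<dots> = (\<Sum>s\<le>Suc a. B (Suc a) s * F s (Suc a - s))"
    by (subst sum.atMost_Suc_shift) (simp add: B)
  finally show ?case by (simp add: F_def B_def)
qed (simp add: sconst_simps)

lemma contr_dpow:
  assumes "d \<in> Der phi"
  shows "contr i (dpow d j) = (if j = 0 then 0 else sconst (c i d) * dpow d (j - 1))"
proof (rule shuf_eqI)
  fix xs
  have "shuf_nth (contr i (dpow d j)) xs = c i (\<lambda>x. shuf_nth (shift x (dpow d j)) xs)" by simp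
  also have "\<dots> = c i (\<lambda>x. (if j = 0 then 0 else shuf_nth (dpow d (j - 1)) xs) * d x)"
    by (simp add: shift_dpow mult.commute)
  also have "\<dots> = shuf_nth (if j = 0 then 0 else sconst (c i d) * dpow d (j - 1)) xs"
    by (simp only: c_scale[OF assms]) (simp add: mult.commute)
  finally show "shuf_nth (contr i (dpow d j)) xs = shuf_nth (if j = 0 then 0 else sconst (c i d) * dpow d (j - 1)) xs" .
qed

lemma contr_pow_dpow:
  assumes "d \<in> Der phi"
  shows "(contr i ^^ a) (dpow d j) = (if a \<le> j then sconst (c i d ^ a) * dpow d (j - a) else 0)"
proof (induction a)
  case (Suc a)
  show ?case
  proof (cases "a \<le> j")
    case True
    have "(contr i ^^ Suc a) (dpow d j) = contr i (sconst (c i d ^ a) * dpow d (j - a))"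
      using Suc True by simp
    also have "\<dots> = sconst (c i d ^ a) * contr i (dpow d (j - a))"
      by (intro contr_sconst_mult mder_dpow assms)
    finally show ?thesis using True by (auto simp: contr_dpow assms sconst_simps ac_simps)
  next
    case False
    then show ?thesis using Suc by (simp add: contr_0)
  qed
qed (simp add: sconst_simps)

end

section \<open>Expanding multiderivations in divided powers of the basis\<close>

lemma gconst_simps:
  "gconst 0 = 0" "gconst 1 = 1" "gconst (a + a') = gconst a + gconst a'"
  "gconst (a * a') = gconst a * gconst a'"
  by (simp_all add: gconst_def single_add mult_single flip: zero_multiset_def)

lemma gconst_of_nat: "gconst (of_nat n) = of_nat n"
  by (induction n) (simp_all add: gconst_simps)

lemma gvar_mult_single:
  "gvar d j * Poly_Mapping.single m 1 = Poly_Mapping.single (add_mset (d, j) m) 1"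
  by (simp add: gvar_def mult_single)

lemma gconst_mult_single: "gconst a * Poly_Mapping.single m 1 = Poly_Mapping.single m a"
  by (simp add: gconst_def mult_single)

context der_basis
begin

abbreviation gamma_cong :: "'a gpoly \<Rightarrow> 'a gpoly \<Rightarrow> bool" (infix "\<approx>" 50) where
  "f \<approx> g \<equiv> gcong (Der phi) f g"

text \<open>For a homogeneous multiderivation u of degree n, expn r n u is the sum over all multi-indices
  \<open>\<alpha>\<close> with \<open>|\<alpha>| = n\<close> of the iterated contraction \<open>c\<^sup>\<alpha>(u)\<close> times \<open>\<Prod>\<^sub>i \<gamma>\<^bsub>\<alpha>\<^sub>i\<^esub>(b\<^sub>i)\<close>.\<close>
primrec expn :: "nat \<Rightarrow> nat \<Rightarrow> 'a shuf \<Rightarrow> 'a gpoly" where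
  "expn 0 n u = (if n = 0 then gconst (shuf_nth u []) else 0)"
| "expn (Suc k) n u = (\<Sum>a\<le>n. gvar (b k) a * expn k (n - a) ((contr k ^^ a) u))"

lemma gpoly_over_expn: "gpoly_over (Der phi) (expn k n u)"
  by (induction k arbitrary: n u)
    (auto intro!: gpoly_over_sum gpoly_over_mult gpoly_over_gvar b_Der gpoly_over_0 gpoly_over_gconst)

lemma ghomog_expn: "ghomog n (expn k n u)"
proof (induction k arbitrary: n u)
  case (Suc k)
  have "ghomog n (gvar (b k) a * expn k (n - a) ((contr k ^^ a) u))" if "a \<le> n" for a
    using ghomog_mult[OF ghomog_gvar[of a "b k"] Suc[of "n - a" "(contr k ^^ a) u"]] that by simp
  then show ?case unfolding expn.simps by (intro ghomog_sum) simp
qed (simp add: ghomog_0 ghomog_gconst)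

lemma expn_zero: "expn k n 0 = 0"
  by (induction k arbitrary: n) (simp_all add: gconst_simps contr_pow_0)

lemma expn_add: "mder u \<Longrightarrow> mder v \<Longrightarrow> expn k n (u + v) = expn k n u + expn k n v"
  by (induction k arbitrary: n u v)
    (simp_all add: gconst_simps contr_pow_add mder_contr_pow distrib_left sum.distrib)

lemma expn_sconst_mult: "mder u \<Longrightarrow> expn k n (sconst e * u) = gconst e * expn k n u"
  by (induction k arbitrary: n u)
    (simp_all add: gconst_simps shuf_nth_sconst contr_pow_sconst_mult mder_contr_pow sum_distrib_left mult.left_commute)

lemma expn_sum: "(\<And>i. i \<in> I \<Longrightarrow> mder (u i)) \<Longrightarrow> expn k n (\<Sum>i\<in>I. u i) = (\<Sum>i\<in>I. expn k n (u i))"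
  by (induction I rule: infinite_finite_induct) (auto simp: expn_zero expn_add mder_sum)

text \<open>The Leibniz formula for the \<open>i\<close>-fold contraction of a product carries
  \<open>i choose s\<close>; the product relation of \<Gamma> absorbs this coefficient by splitting
  the \<open>i\<close>-th divided power of \<open>b k\<close> into those of degrees \<open>s\<close>
  and \<open>i - s\<close>.\<close>

lemma expn_mult:
  assumes "mder u" "mder v"
  shows "expn k n (u * v) \<approx> (\<Sum>p\<le>n. expn k p u * expn k (n - p) v)"
  using assms
proof (induction k arbitrary: n u v)
  case 0
  have "(\<Sum>p\<le>n. expn 0 p u * expn 0 (n - p) v) = expn 0 n (u * v)"
  proof (cases n)
    case (Suc m)
    have "(\<Sum>p\<le>n. expn 0 p u * expn 0 (n - p) v) = 0"
      by (rule sum.neutral) (auto simp: Suc)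
    then show ?thesis by (simp add: Suc)
  qed (simp add: gconst_simps)
  then show ?case by (simp only: gcong_refl)
next
  case (Suc k)
  define U where "U = (\<lambda>s. (contr k ^^ s) u)"
  define V where "V = (\<lambda>s. (contr k ^^ s) v)"
  have mU: "mder (U s)" and mV: "mder (V s)" for s
    by (simp_all add: U_def V_def mder_contr_pow Suc.prems)
  let ?g = "gvar (b k)"
  have "(contr k ^^ i) (u * v) = (\<Sum>s\<le>i. sconst (of_nat (i choose s)) * (U s * V (i - s)))" for i
    unfolding U_def V_def by (rule contr_pow_mult[OF Suc.prems])
  then have "expn (Suc k) n (u * v) =
      (\<Sum>i\<le>n. \<Sum>s\<le>i. ?g i * (of_nat (i choose s) * expn k (n - i) (U s * V (i - s))))"
    by (simp add: expn_sum expn_sconst_mult mder_mult mder_sconst_mult mU mV gconst_of_nat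
        sum_distrib_left)
  also have "\<dots> = (\<Sum>i\<le>n. \<Sum>s\<le>i. (of_nat (i choose s) * ?g i) * expn k (n - i) (U s * V (i - s)))"
    by (simp only: mult.assoc mult.left_commute)
  also have "\<dots> \<approx> (\<Sum>i\<le>n. \<Sum>s\<le>i. (?g s * ?g (i - s)) *
      (\<Sum>q\<le>n - i. expn k q (U s) * expn k (n - i - q) (V (i - s))))"
  proof (rule gcong_sum, rule gcong_sum, rule gcong_mult)
    fix i s :: nat assume "s \<in> {..i}"
    then show "of_nat (i choose s) * ?g i \<approx> ?g s * ?g (i - s)"
      using gcong_sym[OF gcong_rels(2)[OF b_Der, of k s "i - s"]] by simp
    show "gpoly_over (Der phi) (of_nat (i choose s) * ?g i)"
      using gpoly_over_gconst[of "Der phi" "of_nat (i choose s)"]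
      by (auto simp: gconst_of_nat intro: gpoly_over_mult gpoly_over_gvar b_Der)
  qed (rule Suc.IH[OF mU mV], auto intro: gpoly_over_sum gpoly_over_mult gpoly_over_expn)
  also have "\<dots> = (\<Sum>i\<le>n. \<Sum>s\<le>i. \<Sum>q\<le>n - i.
      (?g s * expn k q (U s)) * (?g (i - s) * expn k (n - i - q) (V (i - s))))"
    by (simp only: sum_distrib_left, intro sum.cong refl, simp only: mult.assoc mult.left_commute)
  \<comment> \<open>From grouping by the exponent \<open>i\<close> of \<open>b k\<close> to grouping
    by the degree \<open>m\<close> that falls to \<open>u\<close>.\<close>
  also have "\<dots> = (\<Sum>m\<le>n. \<Sum>s\<le>m. \<Sum>p\<le>n - m.
      (?g s * expn k (m - s) (U s)) * (?g p * expn k (n - m - p) (V p)))"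
    by (rule sum_regroup[of "\<lambda>s p q q'. (?g s * expn k q (U s)) * (?g p * expn k q' (V p))"])
  also have "\<dots> = (\<Sum>m\<le>n. expn (Suc k) m u * expn (Suc k) (n - m) v)"
    by (simp add: sum_product U_def V_def)
  finally show ?case .
qed

text \<open>Contractions bring out powers of \<open>c i d\<close>, and the scaling and addition
  relations reassemble the divided power of \<open>\<Sum>i<k. c i d * b i x\<close>. At
  \<open>k = r\<close> this sum is \<open>d\<close>.\<close>

lemma expn_dpow:
  assumes d: "d \<in> Der phi"
  shows "expn k n (dpow d j) \<approx> (if n = j then gvar (\<lambda>x. \<Sum>i<k. c i d * b i x) j else 0)"
proof (induction k arbitrary: n j)
  case 0
  \<comment> \<open>Scaling the zero derivation by 0 kills its divided powers of degree
    \<open>j > 0\<close>; degree 0 is the relation that makes it 1.\<close>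
  have "gvar (\<lambda>x. 0) j \<approx> (if j = 0 then 1 else 0)"
    using gcong_rels(1)[OF Der_zero[of phi]] gcong_rels(3)[OF Der_zero[of phi], where a = 0 and j = j]
    by (cases j) (auto simp: gconst_simps)
  from gcong_sym[OF this] show ?case by (auto simp: gconst_simps gcong_refl)
next
  case (Suc k)
  let ?e = "c k d" and ?y = "\<lambda>x. \<Sum>i<k. c i d * b i x"
  have y: "?y \<in> Der phi" by (intro Der_sum Der_times b_Der)
  have "expn (Suc k) n (dpow d j) =
      (\<Sum>a\<le>n. gvar (b k) a * (if a \<le> j then gconst (?e ^ a) * expn k (n - a) (dpow d (j - a)) else 0))"
    by (simp add: contr_pow_dpow[OF d] expn_sconst_mult mder_dpow[OF d] expn_zero if_distrib cong: if_cong)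
  also have "\<dots> \<approx> (\<Sum>a\<le>n. if n = j then gvar (\<lambda>x. ?e * b k x) a * gvar ?y (j - a) else 0)"
  proof (rule gcong_sum)
    fix a assume a: "a \<in> {..n}"
    show "gvar (b k) a * (if a \<le> j then gconst (?e ^ a) * expn k (n - a) (dpow d (j - a)) else 0) \<approx>
      (if n = j then gvar (\<lambda>x. ?e * b k x) a * gvar ?y (j - a) else 0)"
    proof (cases "a \<le> j")
      case True
      have ac: "gvar (b k) a * (gconst (?e ^ a) * f) = (gconst (?e ^ a) * gvar (b k) a) * f" for f
        by (simp only: ac_simps)
      have "(gconst (?e ^ a) * gvar (b k) a) * expn k (n - a) (dpow d (j - a)) \<approx>
        gvar (\<lambda>x. ?e * b k x) a * (if n - a = j - a then gvar ?y (j - a) else 0)"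
        by (rule gcong_mult[OF gcong_sym[OF gcong_rels(3)[OF b_Der]] Suc])
          (auto intro: gpoly_over_mult gpoly_over_gconst gpoly_over_gvar b_Der y gpoly_over_0)
      moreover have "n - a = j - a \<longleftrightarrow> n = j" using a True by auto
      ultimately show ?thesis using True by (cases "n = j") (simp_all add: ac)
    next
      case False
      then have "n \<noteq> j" using a by auto
      then show ?thesis using False by (simp add: gcong_refl)
    qed
  qed
  also have "\<dots> \<approx> (if n = j then gvar (\<lambda>x. \<Sum>i<Suc k. c i d * b i x) j else 0)"
    using gcong_sym[OF gcong_rels(4)[OF Der_times[OF b_Der] y, of ?e k j]]
    by (auto simp: gcong_refl add.commute)
  finally show ?case .
qed

lemma expn_csym_mono:
  "fst ` set_mset m \<subseteq> Der phi \<Longrightarrow>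
    expn r n (csym_mono m) \<approx> (if n = gdeg m then Poly_Mapping.single m 1 else 0)"
proof (induction m arbitrary: n)
  case empty
  \<comment> \<open>The empty product is written as a divided power of degree 0, so that
    \<open>expn_dpow\<close> covers it.\<close>
  have "expn r n (dpow (\<lambda>x. 0) 0) \<approx> (if n = 0 then gvar (\<lambda>x. \<Sum>i<r. c i (\<lambda>x. 0) * b i x) 0 else 0)"
    by (rule expn_dpow[OF Der_zero])
  also have "\<dots> \<approx> (if n = 0 then 1 else 0)"
    using gcong_rels(1)[OF Der_zero[of phi]] by (simp add: c_zero gcong_refl)
  also have "(1 :: 'a gpoly) = Poly_Mapping.single {#} 1"
    using gconst_simps(2)[symmetric] by (simp only: gconst_def)
  finally show ?case by (simp add: csym_mono_def gdeg_def)
next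
  case (add v m)
  obtain d j where v: "v = (d, j)" by fastforce
  have d: "d \<in> Der phi" and m: "fst ` set_mset m \<subseteq> Der phi" using add.prems v by auto
  have dd: "(\<lambda>x. \<Sum>i<r. c i d * b i x) = d" using expand[OF d] by auto
  have "expn r n (csym_mono (add_mset v m)) = expn r n (dpow d j * csym_mono m)"
    by (simp add: v csym_mono_def)
  also have "\<dots> \<approx> (\<Sum>p\<le>n. expn r p (dpow d j) * expn r (n - p) (csym_mono m))"
    by (intro expn_mult mder_dpow mder_csym_mono d m)
  also have "\<dots> \<approx> (\<Sum>p\<le>n. (if p = j then gvar d j else 0) *
      (if n - p = gdeg m then Poly_Mapping.single m 1 else 0))"
  proof (rule gcong_sum, rule gcong_mult)
    fix p
    show "expn r p (dpow d j) \<approx> (if p = j then gvar d j else 0)"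
      using expn_dpow[OF d, of r p j] unfolding dd .
    show "expn r (n - p) (csym_mono m) \<approx> (if n - p = gdeg m then Poly_Mapping.single m 1 else 0)"
      by (rule add.IH[OF m])
    show "gpoly_over (Der phi) (if n - p = gdeg m then Poly_Mapping.single m 1 else 0)"
      using m by (auto simp: gpoly_over_def)
  qed (rule gpoly_over_expn)
  also have "\<dots> = (\<Sum>p\<le>n. if p = j then gvar d j * (if n - j = gdeg m then Poly_Mapping.single m 1 else 0) else 0)"
    by (rule sum.cong) auto
  also have "\<dots> = (if n = gdeg (add_mset v m) then Poly_Mapping.single (add_mset v m) 1 else 0)"
    by (auto simp: sum.delta gvar_mult_single v gdeg_def)
  finally show ?case .
qed

text \<open>With \<open>expn_zero\<close> this gives injectivity of \<open>csym\<close> modulo the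
  ideal; \<open>csym_expn\<close> is the matching surjectivity.\<close>

lemma expn_csym:
  assumes f: "gpoly_over (Der phi) f" "ghomog n f"
  shows "expn r n (csym f) \<approx> f"
proof -
  let ?K = "Poly_Mapping.keys f" and ?f = "Poly_Mapping.lookup f"
  have m: "mder (csym_mono m)" if "m \<in> ?K" for m
    by (rule mder_csym_mono[OF gpoly_over_keys[OF f(1) that]])
  have "expn r n (csym f) = (\<Sum>m\<in>?K. gconst (?f m) * expn r n (csym_mono m))"
    by (simp add: csym_def expn_sum expn_sconst_mult m mder_sconst_mult)
  also have "\<dots> \<approx> (\<Sum>m\<in>?K. gconst (?f m) * Poly_Mapping.single m 1)"
  proof (intro gcong_sum gcong_mult_left gpoly_over_gconst)
    fix m assume m: "m \<in> ?K"
    then have "n = gdeg m" using f(2) by (simp add: ghomog_def)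
    then show "expn r n (csym_mono m) \<approx> Poly_Mapping.single m 1"
      using expn_csym_mono[OF gpoly_over_keys[OF f(1) m], of n] by simp
  qed
  also have "\<dots> = f"
    by (simp add: gconst_mult_single flip: poly_mapping_eq_sum_single)
  finally show ?thesis .
qed

lemma csym_eq_0_imp_Gamma_ideal:
  assumes "gpoly_over (Der phi) f" "ghomog n f" "csym f = 0"
  shows "f \<in> Gamma_ideal (Der phi)"
  using gcong_sym[OF expn_csym[OF assms(1,2)]] assms(3) by (simp add: expn_zero gcong_def)

section \<open>Symmetric multiderivations as combinations of divided powers\<close>

definition symder :: "'a shuf \<Rightarrow> bool" where
  "symder u \<longleftrightarrow> (\<forall>xs ys. mset xs = mset ys \<longrightarrow> shuf_nth u xs = shuf_nth u ys) \<and>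
    (\<forall>zs. (\<lambda>x. shuf_nth u (x # zs)) \<in> Der phi)"

lemma symder_swap: "symder u \<Longrightarrow> shuf_nth u (x # y # zs) = shuf_nth u (y # x # zs)"
  unfolding symder_def by (metis add_mset_commute mset.simps(2))

lemma symder_first: "symder u \<Longrightarrow> (\<lambda>x. shuf_nth u (x # zs)) \<in> Der phi"
  by (simp add: symder_def)

lemma symder_second: "symder u \<Longrightarrow> (\<lambda>y. shuf_nth u (x # y # zs)) \<in> Der phi"
  by (simp add: symder_swap[of u x] symder_first)

lemma symder_contr:
  assumes u: "symder u" shows "symder (contr i u)"
  unfolding symder_def
proof (intro conjI allI impI)
  fix xs ys :: "'a list" assume "mset xs = mset ys"
  then have "shuf_nth u (x # xs) = shuf_nth u (x # ys)" for x
    using u by (simp add: symder_def)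
  then show "shuf_nth (contr i u) xs = shuf_nth (contr i u) ys" by simp
next
  fix zs
  show "(\<lambda>x. shuf_nth (contr i u) (x # zs)) \<in> Der phi"
    unfolding shuf_nth_contr by (rule c_Der) (intro symder_first symder_second u)+
qed

text \<open>The inner contraction takes the first slot and the outer one the second.
  \<open>c_commute\<close> exchanges the forms, and symmetry exchanges the slots.\<close>

lemma contr_commute:
  assumes u: "symder u" shows "contr i (contr k u) = contr k (contr i u)"
proof (rule shuf_eqI)
  fix xs
  have "c i (\<lambda>y. c k (\<lambda>x. shuf_nth u (x # y # xs))) = c k (\<lambda>x. c i (\<lambda>y. shuf_nth u (x # y # xs)))"
    by (rule c_commute) (intro symder_first symder_second u)+
  then show "shuf_nth (contr i (contr k u)) xs = shuf_nth (contr k (contr i u)) xs"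
    by (simp add: symder_swap[OF u])
qed

lemma symder_contr_pow: "symder u \<Longrightarrow> symder ((contr i ^^ a) u)"
  by (induction a) (simp_all add: symder_contr)

lemma contr_pow_commute: "symder u \<Longrightarrow> contr i ((contr k ^^ a) u) = (contr k ^^ a) (contr i u)"
proof (induction a)
  case (Suc a)
  then show ?case using contr_commute[OF symder_contr_pow[OF Suc.prems, of a k], of i k] by simp
qed simp

lemma csym_expn_Suc:
  "csym (expn (Suc k) n u) = (\<Sum>a\<le>n. dpow (b k) a * csym (expn k (n - a) ((contr k ^^ a) u)))"
  by (simp add: csym_sum csym_mult csym_gvar)

lemma shift_csym_expn_degree_0: "shift x (csym (expn k 0 u)) = 0"
  by (induction k arbitrary: u) (simp_all add: csym_gconst csym_mult csym_gvar)

text \<open>Removing \<open>x\<close> from a divided power of \<open>b i\<close> gives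
  \<open>b i x\<close> and lowers its exponent, so one contraction along \<open>i\<close> is left
  over. As contractions commute, it can be applied to \<open>u\<close> beforehand.\<close>

lemma shift_csym_expn:
  assumes "symder u"
  shows "shift x (csym (expn k (Suc n) u)) = (\<Sum>i<k. sconst (b i x) * csym (expn k n (contr i u)))"
  using assms
proof (induction k arbitrary: n u)
  case 0
  then show ?case by (simp add: csym_0)
next
  case (Suc k)
  define S where "S = (\<lambda>a n. csym (expn k n ((contr k ^^ a) u)))"
  define T where "T = (\<lambda>a n i. csym (expn k n ((contr k ^^ a) (contr i u))))"
  have S: "shift x (S a (Suc m)) = (\<Sum>i<k. sconst (b i x) * T a m i)" for a m
    using Suc.IH[OF symder_contr_pow[OF Suc.prems, of a k], of m]
    by (simp add: S_def T_def contr_pow_commute[OF Suc.prems])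
  have S0: "shift x (S a 0) = 0" for a
    by (simp add: S_def shift_csym_expn_degree_0)
  have "shift x (csym (expn (Suc k) (Suc n) u)) =
      (\<Sum>a\<le>Suc n. shift x (dpow (b k) a) * S a (Suc n - a)) +
      (\<Sum>a\<le>Suc n. dpow (b k) a * shift x (S a (Suc n - a)))"
    by (simp only: csym_expn_Suc S_def shift_sum shift_mult sum.distrib)
  also have "(\<Sum>a\<le>Suc n. shift x (dpow (b k) a) * S a (Suc n - a)) =
      sconst (b k x) * csym (expn (Suc k) n (contr k u))"
    unfolding csym_expn_Suc
    by (subst sum.atMost_Suc_shift)
      (simp add: S_def shift_dpow sum_distrib_left mult.assoc funpow_swap1)
  also have "(\<Sum>a\<le>Suc n. dpow (b k) a * shift x (S a (Suc n - a))) =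
      (\<Sum>a\<le>n. \<Sum>i<k. sconst (b i x) * (dpow (b k) a * T a (n - a) i))"
    by (simp add: S0 S Suc_diff_le sum_distrib_left mult.left_commute)
  also have "\<dots> = (\<Sum>i<k. sconst (b i x) * csym (expn (Suc k) n (contr i u)))"
    unfolding csym_expn_Suc T_def by (subst sum.swap) (simp add: sum_distrib_left)
  finally show ?case by (simp add: add.commute)
qed

text \<open>Reading one letter \<open>x\<close> leaves
  \<open>\<Sum>i<r. b i x * shuf_nth (contr i u) xs\<close>, which is the dual basis expansion of
  \<open>u\<close> as a derivation in its first slot.\<close>

lemma csym_expn:
  assumes u: "symder u" "shom n u"
  shows "csym (expn r n u) = u"
proof (rule shuf_eqI)
  have N: "shuf_nth (csym (expn k 0 u)) [] = shuf_nth u []" for k u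
    by (induction k arbitrary: u) (simp_all add: csym_gconst csym_mult csym_gvar shuf_nth_sconst)
  \<comment> \<open>The degree is tied to the length of the word instead of to \<open>u\<close>, so
    the induction passes to \<open>contr i u\<close> without tracking homogeneity.\<close>
  have *: "shuf_nth (csym (expn r (length xs) u)) xs = shuf_nth u xs" if "symder u" for xs u
    using that
  proof (induction xs arbitrary: u)
    case Nil
    then show ?case using N by simp
  next
    case (Cons x xs)
    have "shuf_nth (csym (expn r (length (x # xs)) u)) (x # xs) =
        shuf_nth (shift x (csym (expn r (Suc (length xs)) u))) xs" by simp
    also have "\<dots> = (\<Sum>i<r. b i x * shuf_nth (contr i u) xs)"
      unfolding shift_csym_expn[OF Cons.prems]
      by (simp add: shuf_nth_sum Cons.IH symder_contr Cons.prems del: shuf_nth_contr)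
    also have "\<dots> = shuf_nth u (x # xs)"
      using expand[OF symder_first[OF Cons.prems], of x xs] by (simp add: mult.commute)
    finally show ?case .
  qed
  fix xs
  show "shuf_nth (csym (expn r n u)) xs = shuf_nth u xs"
  proof (cases "length xs = n")
    case True
    then show ?thesis using *[OF u(1), of xs] by simp
  next
    case False
    then show ?thesis using u(2) shom_csym[OF ghomog_expn] by (simp add: shom_def)
  qed
qed

section \<open>Lifting multiderivations to operators\<close>

lemma symhom_symder:
  assumes "symhom phi n u" shows "symder (Shuf u)" "shom n (Shuf u)"
proof -
  have 0: "u xs = 0" if "length xs \<noteq> n" for xs using assms that by (simp add: symhom_def)
  have "u xs = u ys" if "mset xs = mset ys" for xs ys
  proof (cases "length xs = n")
    case True
    then show ?thesis using assms that by (auto simp: symhom_def)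
  next
    case False
    moreover have "length ys \<noteq> n" using False that by (metis size_mset)
    ultimately show ?thesis by (simp add: 0)
  qed
  moreover have "(\<lambda>x. u (x # zs)) \<in> Der phi" for zs
  proof (cases "Suc (length zs) = n")
    case True
    then have "u ((x + y) # zs) = u (x # zs) + u (y # zs)" "u ((phi e * x) # zs) = phi e * u (x # zs)"
      "u ((x * y) # zs) = x * u (y # zs) + y * u (x # zs)" for x y e
      using assms unfolding symhom_def by blast+
    then show ?thesis unfolding Der_def klin_def by blast
  next
    case False
    then show ?thesis by (simp add: 0 Der_zero)
  qed
  ultimately show "symder (Shuf u)" unfolding symder_def shuf_nth_Shuf by blast
  show "shom n (Shuf u)" using 0 by (simp add: shom_def)
qed

text \<open>The same witness settles both surjectivity statements: the operator of
  \<open>expn r n (Shuf u)\<close> has symbol \<open>u\<close>, and it comes from a divided power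
  polynomial.\<close>

lemma symhom_lift:
  assumes I: "Ider phi = Der phi" and u: "symhom phi n u"
  shows "\<exists>f. gpoly_over (Ider phi) f \<and> ghomog n f \<and> diffop phi n (varthetaP phi f) \<and>
    thetaN n (varthetaP phi f) = u"
proof (intro exI conjI)
  let ?f = "expn r n (Shuf u)"
  show f: "gpoly_over (Ider phi) ?f" "ghomog n ?f"
    by (simp_all add: I gpoly_over_expn ghomog_expn)
  show "diffop phi n (varthetaP phi ?f)" by (rule symb_varthetaP[OF f])
  have "symb n (varthetaP phi ?f) = Shuf u"
    using symb_varthetaP(2)[OF f] csym_expn[OF symhom_symder[OF u]] by simp
  then show "thetaN n (varthetaP phi ?f) = u"
    by (metis shuf_nth_Shuf symb_def)
qed

lemma Ider_eq_Der_imp_theta_iso: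
  assumes "Ider phi = Der phi" shows "theta_iso phi"
  using symhom_lift[OF assms] symhom_thetaN lowerord_iff_thetaN unfolding theta_iso_def by blast

lemma Ider_eq_Der_imp_vartheta_iso:
  assumes I: "Ider phi = Der phi" shows "vartheta_iso phi"
  unfolding vartheta_iso_def
proof (intro allI conjI impI)
  fix n f assume f: "gpoly_over (Ider phi) f" "ghomog n f"
  show P: "diffop phi n (varthetaP phi f)" by (rule symb_varthetaP[OF f])
  have "lowerord phi n (varthetaP phi f) \<longleftrightarrow> thetaN n (varthetaP phi f) = (\<lambda>xs. 0)"
    by (rule lowerord_iff_thetaN[OF P])
  also have "\<dots> \<longleftrightarrow> csym f = 0"
    unfolding symb_varthetaP(2)[OF f, symmetric] symb_def zero_shuf_def by (simp add: Shuf_inject)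
  also have "\<dots> \<longleftrightarrow> f \<in> Gamma_ideal (Ider phi)"
    using csym_eq_0_imp_Gamma_ideal[of f n] csym_Gamma_ideal f I by metis
  finally show "lowerord phi n (varthetaP phi f) \<longleftrightarrow> f \<in> Gamma_ideal (Ider phi)" .
next
  fix n P assume P: "diffop phi n P"
  obtain f where f: "gpoly_over (Ider phi) f" "ghomog n f" "diffop phi n (varthetaP phi f)"
    "thetaN n (varthetaP phi f) = thetaN n P"
    using symhom_lift[OF I symhom_thetaN[OF P]] by blast
  have "lowerord phi n (\<lambda>x. P x - varthetaP phi f x)"
    unfolding lowerord_iff_thetaN[OF diffop_subtract[OF P f(3)]] by (simp add: thetaN_diff f(4) fun_eq_iff)
  then show "\<exists>f. gpoly_over (Ider phi) f \<and> ghomog n f \<and> lowerord phi n (\<lambda>x. P x - varthetaP phi f x)"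
    using f by blast
qed

end

theorem mainTheorem14:
  fixes phi :: "'k::comm_ring_1 \<Rightarrow> 'a::comm_ring_1"
  assumes "is_alg_map phi"
    and "fin_proj_module (Der phi)"
  shows "(theta_iso phi \<longleftrightarrow> vartheta_iso phi) \<and> (vartheta_iso phi \<longleftrightarrow> Ider phi = Der phi)"
proof -
  obtain r b c where "der_basis phi r b c"
    using fin_proj_module_imp_der_basis[OF assms(2)] by blast
  then interpret der_basis phi r b c .
  have "theta_surj phi" if "theta_iso phi"
    using that unfolding theta_iso_def theta_surj_def by blast
  then show ?thesis
    using theta_surj_imp_Ider_eq_Der vartheta_iso_imp_Ider_eq_Der
      Ider_eq_Der_imp_theta_iso Ider_eq_Der_imp_vartheta_iso by blast
qed

end
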